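(* Consider the problem of minimizing $J(x(\cdot))=\int_{t_0}^{t_1}L(t,x(t),\dot x(t))\,dt$ over $x(\cdot)\in KC^1(I,\mathbb R^n)$ with $x(t_0)=x_0$, $x(t_1)=x_1$. Let the functions $L$ and $L_{\dot x}$ be continuously differentiable in the totality of their variables, and let the admissible function $\bar x(\cdot)$ be a strong local minimum in this problem. Then: (i) Let $\theta\in[t_0,t_1)$ (respectively $\theta\in(t_0,t_1]$), and suppose $\bar x(\cdot)$ is twice differentiable on the right (left) in a semi-neighborhood $[\theta,\theta+\alpha)\subset I$ (respectively $(\theta-\alpha,\theta]\subset I$), $\alpha>0$, of $\theta$. Suppose that for a vector $\eta\ne0$, $\eta\in\mathbb R^n$, and a number $\bar\lambda\in(0,1)$ $$E(\bar L)(\theta+,\eta)=E(\bar L)\big(\theta+,(\bar\lambda-1)^{-1}\bar\lambda\eta\big)=0$$ $$\Big(\text{respectively } E(\bar L)(\theta-,\eta)=E(\bar L)\big(\theta-,(\bar\lambda-1)^{-1}\bar\lambda\eta\big)=0\Big).$$ Then $$\bar\lambda M_1(\bar L_x)(\theta+,\bar\lambda,\eta)+\frac{d}{dt}Q_2(\bar L)(\theta+,\bar\lambda,\eta)\ge0$$ $$\Big(\text{respectively } \bar\lambda M_1(\bar L_x)(\theta-,\bar\lambda,\eta)+\frac{d}{dt}Q_2(\bar L)(\theta-,\bar\lambda,\eta)\le0\Big).$$ (ii) Let $\theta\in(t_0,t_1)$, suppose $\bar x(\cdot)$ is twice differentiable at $\theta$, and suppose that for a vector $\eta\neq 0$ and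 a number $\bar\lambda\in(0,1)$ $$E(\bar L)(\theta,\eta)=E(\bar L)\big(\theta,(\bar\lambda-1)^{-1}\bar\lambda\eta\big)=0.$$ Then $$\bar\lambda\,\Delta\bar L_x^T(\theta,\eta)\eta+(1-\bar\lambda)\,\Delta\bar L_x^T\big(\theta,(\bar\lambda-1)^{-1}\bar\lambda\eta\big)\eta=0.$$
   Context: Setting. $(a,b)\subset\mathbb R$ is an interval, $I:=[t_0,t_1]\subset(a,b)$ with $t_0<t_1$, $x_0,x_1\in\mathbb R^n$, and $L=L(t,x,\dot x):(a,b)\times\mathbb R^n\times\mathbb R^n\to\mathbb R$ is continuously differentiable in the totality of variables; $L_x,L_{\dot x}$ are its partial gradients (column vectors) with respect to the second and third arguments; $T$ denotes transposition. $KC^1(I,\mathbb R^n)$ is the set of piecewise-smooth functions: continuous functions $x:I\to\mathbb R^n$ whose derivative is continuous on $I$ except at finitely many points of $(t_0,t_1)$ (angular points), where $\dot x$ has discontinuities of the first kind (finite one-sided limits); at $t_0$ and $t_1$ the right, respectively left, values of $\dot x$ are finite. A function $x(\cdot)\in KC^1(I,\mathbb R^n)$ with $x(t_0)=x_0$, $x(t_1)=x_1$ is called admissible. An admissible $\bar x(\cdot)$ is a strong local minimum if there is $\bar\delta>0$ such that $J(x(\cdot))\ge J(\bar x(\cdot))$ for all admissible $x(\cdot)$ with $\|x(\cdot)-\bar x(\cdot)\|_{C(I,\mathbb R^n)}\le\bar\delta$. Notation along $\bar x(\cdot)$, for $\xi\in\mathbb R^n$: $\bar L(t)=L(t,\bar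 x(t),\dot{\bar x}(t))$, $\bar L_x(t)=L_x(t,\bar x(t),\dot{\bar x}(t))$, $\bar L_{\dot x}(t)=L_{\dot x}(t,\bar x(t),\dot{\bar x}(t))$, $$E(\bar L)(t,\xi)=L(t,\bar x(t),\dot{\bar x}(t)+\xi)-\bar L(t)-\bar L_{\dot x}^T(t)\xi,\qquad \Delta\bar L_x(t,\xi)=L_x(t,\bar x(t),\dot{\bar x}(t)+\xi)-\bar L_x(t),$$ and, for $\lambda\in[0,1)$, $$Q_2(\bar L)(t,\lambda,\xi)=\lambda^2E(\bar L)(t,\xi)+(1-\lambda^2)E(\bar L)\Big(t,\tfrac{\lambda}{\lambda-1}\xi\Big),$$ $$M_1(\bar L_x)(t,\lambda,\xi)=\lambda\,\Delta\bar L_x^T(t,\xi)\xi+(1-\lambda)\,\Delta\bar L_x^T\Big(t,\tfrac{\lambda}{\lambda-1}\xi\Big)\xi.$$ One-sided values: $F(\theta+)$ (resp. $F(\theta-)$) is the right-hand (left-hand) limit of $F$ at $\theta$; for the functions above it is obtained by using $\dot{\bar x}(\theta+)$ (resp. $\dot{\bar x}(\theta-)$) in place of $\dot{\bar x}(\theta)$. $\frac{d}{dt}F(\theta\pm,\cdot)$ is the corresponding one-sided derivative at $\theta$ of $t\mapsto F(t,\cdot)$ (other arguments fixed), where the value at $\theta$ is taken to be $F(\theta\pm,\cdot)$. *)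

theory Defs
  imports "HOL-Analysis.Analysis"
begin

definition C1_on :: "('a::real_normed_vector \<Rightarrow> 'b::real_normed_vector) \<Rightarrow> 'a set \<Rightarrow> bool" where
  "C1_on f S \<longleftrightarrow> (\<exists>f' :: 'a \<Rightarrow> 'a \<Rightarrow>\<^sub>L 'b.
     (\<forall>p\<in>S. (f has_derivative blinfun_apply (f' p)) (at p)) \<and> continuous_on S f')"

definition grad :: "('a::real_inner \<Rightarrow> real) \<Rightarrow> 'a \<Rightarrow> 'a" where
  "grad f y = (THE D. GDERIV f y :> D)"

(* An integrand is a function of the triple (t, x, v), v standing for the velocity. *)
type_synonym 'n integrand = "real \<times> (real ^ 'n) \<times> (real ^ 'n) \<Rightarrow> real"

definition L_x :: "('n::finite) integrand \<Rightarrow> real \<times> (real ^ 'n) \<times> (real ^ 'n) \<Rightarrow> real ^ 'n" where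
  "L_x L = (\<lambda>(t, x, v). grad (\<lambda>y. L (t, y, v)) x)"

definition L_v :: "('n::finite) integrand \<Rightarrow> real \<times> (real ^ 'n) \<times> (real ^ 'n) \<Rightarrow> real ^ 'n" where
  "L_v L = (\<lambda>(t, x, v). grad (\<lambda>w. L (t, x, w)) v)"

(* One-sided derivative at the end points of the interval; unspecified at angular points. *)
definition vel :: "real \<Rightarrow> real \<Rightarrow> (real \<Rightarrow> 'a::real_normed_vector) \<Rightarrow> real \<Rightarrow> 'a" where
  "vel t0 t1 x t = vector_derivative x (at t within {t0..t1})"

(* The velocity whose value at \<theta> is replaced by its right-hand (left-hand) limit at \<theta>.
   Evaluating F along these functions gives F(\<theta>+) and F(\<theta>-). *)
definition vel_right :: "real \<Rightarrow> real \<Rightarrow> (real \<Rightarrow> 'a::real_normed_vector) \<Rightarrow> real \<Rightarrow> real \<Rightarrow> 'a" where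
  "vel_right t0 t1 x \<theta> = (vel t0 t1 x)(\<theta> := Lim (at_right \<theta>) (vel t0 t1 x))"

definition vel_left :: "real \<Rightarrow> real \<Rightarrow> (real \<Rightarrow> 'a::real_normed_vector) \<Rightarrow> real \<Rightarrow> real \<Rightarrow> 'a" where
  "vel_left t0 t1 x \<theta> = (vel t0 t1 x)(\<theta> := Lim (at_left \<theta>) (vel t0 t1 x))"

(* S contains the angular points. Values of x outside {t0..t1} are irrelevant. *)
definition KC1 :: "real \<Rightarrow> real \<Rightarrow> (real \<Rightarrow> 'a::real_normed_vector) set" where
  "KC1 t0 t1 = {x. continuous_on {t0..t1} x \<and>
     (\<exists>S. finite S \<and> S \<subseteq> {t0<..<t1} \<and>
        (\<forall>t\<in>{t0..t1} - S. x differentiable (at t within {t0..t1})) \<and>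
        continuous_on ({t0..t1} - S) (vel t0 t1 x) \<and>
        (\<forall>s\<in>S. (\<exists>l. (vel t0 t1 x \<longlongrightarrow> l) (at_left s)) \<and>
               (\<exists>r. (vel t0 t1 x \<longlongrightarrow> r) (at_right s))))}"

definition admissible ::
  "real \<Rightarrow> real \<Rightarrow> 'a::real_normed_vector \<Rightarrow> 'a \<Rightarrow> (real \<Rightarrow> 'a) \<Rightarrow> bool" where
  "admissible t0 t1 x0 x1 x \<longleftrightarrow> x \<in> KC1 t0 t1 \<and> x t0 = x0 \<and> x t1 = x1"

definition J :: "('n::finite) integrand \<Rightarrow> real \<Rightarrow> real \<Rightarrow> (real \<Rightarrow> real ^ 'n) \<Rightarrow> real" where
  "J L t0 t1 x = integral {t0..t1} (\<lambda>t. L (t, x t, vel t0 t1 x t))"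

definition strong_local_min :: "('n::finite) integrand \<Rightarrow> real \<Rightarrow> real \<Rightarrow>
    real ^ 'n \<Rightarrow> real ^ 'n \<Rightarrow> (real \<Rightarrow> real ^ 'n) \<Rightarrow> bool" where
  "strong_local_min L t0 t1 x0 x1 xb \<longleftrightarrow> admissible t0 t1 x0 x1 xb \<and>
     (\<exists>\<delta>>0. \<forall>x. admissible t0 t1 x0 x1 x \<longrightarrow> (SUP t\<in>{t0..t1}. norm (x t - xb t)) \<le> \<delta> \<longrightarrow>
        J L t0 t1 x \<ge> J L t0 t1 xb)"

(* In the next four definitions x is the curve and v its velocity, supplied separately so that
   vel, vel_right or vel_left can be used. *)
definition E :: "('n::finite) integrand \<Rightarrow> (real \<Rightarrow> real ^ 'n) \<Rightarrow> (real \<Rightarrow> real ^ 'n) \<Rightarrow>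
    real \<Rightarrow> real ^ 'n \<Rightarrow> real" where
  "E L x v t \<xi> = L (t, x t, v t + \<xi>) - L (t, x t, v t) - L_v L (t, x t, v t) \<bullet> \<xi>"

definition \<Delta>L_x :: "('n::finite) integrand \<Rightarrow> (real \<Rightarrow> real ^ 'n) \<Rightarrow> (real \<Rightarrow> real ^ 'n) \<Rightarrow>
    real \<Rightarrow> real ^ 'n \<Rightarrow> real ^ 'n" where
  "\<Delta>L_x L x v t \<xi> = L_x L (t, x t, v t + \<xi>) - L_x L (t, x t, v t)"

definition Q2 :: "('n::finite) integrand \<Rightarrow> (real \<Rightarrow> real ^ 'n) \<Rightarrow> (real \<Rightarrow> real ^ 'n) \<Rightarrow>
    real \<Rightarrow> real \<Rightarrow> real ^ 'n \<Rightarrow> real" where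
  "Q2 L x v t lam \<xi> = lam\<^sup>2 * E L x v t \<xi> + (1 - lam\<^sup>2) * E L x v t ((lam / (lam - 1)) *\<^sub>R \<xi>)"

definition M1 :: "('n::finite) integrand \<Rightarrow> (real \<Rightarrow> real ^ 'n) \<Rightarrow> (real \<Rightarrow> real ^ 'n) \<Rightarrow>
    real \<Rightarrow> real \<Rightarrow> real ^ 'n \<Rightarrow> real" where
  "M1 L x v t lam \<xi> = lam * (\<Delta>L_x L x v t \<xi> \<bullet> \<xi>)
     + (1 - lam) * (\<Delta>L_x L x v t ((lam / (lam - 1)) *\<^sub>R \<xi>) \<bullet> \<xi>)"

(* At an end point belonging to S the derivatives are the one-sided ones. *)
definition twice_differentiable_on ::
  "(real \<Rightarrow> 'a::real_normed_vector) \<Rightarrow> real set \<Rightarrow> bool" where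
  "twice_differentiable_on x S \<longleftrightarrow>
     x differentiable_on S \<and> (\<lambda>t. vector_derivative x (at t within S)) differentiable_on S"

definition twice_differentiable_at ::
  "(real \<Rightarrow> 'a::real_normed_vector) \<Rightarrow> real \<Rightarrow> bool" where
  "twice_differentiable_at x \<theta> \<longleftrightarrow>
     (\<forall>\<^sub>F t in nhds \<theta>. x differentiable (at t)) \<and>
     (\<lambda>t. vector_derivative x (at t)) differentiable (at \<theta>)"

end

theory Submission
  imports Defs
begin

text \<open>
  The extremal is compared with its perturbation by a tent that is supported on the segment from
  \<open>\<theta>\<close> to \<open>\<theta> + \<sigma> * e\<close>, where \<open>\<sigma> = 1\<close> or \<open>\<sigma> = -1\<close>, and has the slopes \<open>\<eta>\<close> and
  \<open>(\<lambda> / (\<lambda> - 1)) \<eta>\<close>. The increment of the functional is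
  \<open>e (\<lambda> E(\<eta>) + (1 - \<lambda>) E((\<lambda> / (\<lambda> - 1)) \<eta>)) + \<sigma> c e\<^sup>2 / 2 + o(e\<^sup>2)\<close>. Its first-order term
  vanishes by hypothesis, so \<open>\<sigma> c \<ge> 0\<close>, and the one-sided Euler equation identifies \<open>c\<close> with
  \<open>\<lambda> M\<^sub>1 + dQ\<^sub>2/dt\<close>. The Euler equation in turn comes from the first variation along the same
  tents. In part (ii) the Weierstrass condition gives \<open>Q\<^sub>2 \<ge> 0\<close> near \<open>\<theta>\<close>, so \<open>\<theta>\<close> is a
  minimum point of \<open>Q\<^sub>2\<close> and its derivative there is zero.
\<close>

section \<open>Piecewise smooth functions\<close>

text \<open>Only continuity of \<open>L_x\<close> is known, so a second-order Taylor expansion of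
  \<open>L\<close> is out of reach. Instead, on a support of length \<open>e\<close> an error that
  is uniformly \<open>o(e)\<close> integrates to \<open>o(e\<^sup>2)\<close>, and differentiability
  of \<open>L\<close> at single points gives such an error. The coefficients are moments of the
  tent. With legs of lengths \<open>lam * e\<close> and \<open>(1 - lam) * e\<close>, the integrals
  of the distance from \<theta> carry \<open>lam\<^sup>2\<close> and \<open>1 - lam\<^sup>2\<close>,
  the weights of \<open>Q2\<close>. The displacement terms carry \<open>lam\<^sup>2\<close> and
  \<open>- (1 - lam)\<^sup>2\<close>; since \<open>(1 - lam) * (lam / (lam - 1)) = - lam\<close>,
  they become the perturbed part of \<open>lam * M1\<close>. Two terms of the final expression do
  not come from the increment at all: the derivative of \<open>L_v\<close> in the derivative of
  \<open>Q2\<close>, and the unperturbed \<open>L_x\<close> in \<open>M1\<close>. Both have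
  coefficient \<open>lam\<close>, with opposite signs, and the Euler equation says that they cancel.
  For part (ii) the two one-sided inequalities are opposite and concern the same sum, which is
  therefore zero; the minimum property of \<open>Q2\<close> then isolates \<open>M1\<close>.\<close>

lemma KC1_E:
  assumes "x \<in> KC1 t0 t1"
  obtains S where "finite S" "S \<subseteq> {t0<..<t1}" "continuous_on {t0..t1} x"
    "\<And>t. t \<in> {t0..t1} - S \<Longrightarrow> x differentiable (at t within {t0..t1})"
    "continuous_on ({t0..t1} - S) (vel t0 t1 x)"
    "\<And>s. s \<in> S \<Longrightarrow> \<exists>l. (vel t0 t1 x \<longlongrightarrow> l) (at_left s)"
    "\<And>s. s \<in> S \<Longrightarrow> \<exists>r. (vel t0 t1 x \<longlongrightarrow> r) (at_right s)"
  using assms unfolding KC1_def by blast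

lemma vel_eqI:
  assumes "t0 < t1" "t \<in> {t0..t1}" "(x has_vector_derivative v) (at t within {t0..t1})"
  shows "vel t0 t1 x t = v"
  unfolding vel_def using assms
  by (metis box_real(2) vector_derivative_within_cbox)

lemma vel_works:
  assumes "x differentiable (at t within {t0..t1})"
  shows "(x has_vector_derivative vel t0 t1 x t) (at t within {t0..t1})"
  unfolding vel_def using assms vector_derivative_works by blast

lemma tendsto_of_continuous_off_finite:
  fixes v :: "real \<Rightarrow> 'a::real_normed_vector"
  assumes "finite S" "t \<in> {t0<..<t1} - S" "continuous_on ({t0..t1} - S) v"
  shows "(v \<longlongrightarrow> v t) (at t)"
proof -
  have o: "open ({t0<..<t1} - S)" using assms(1) by (simp add: open_Diff finite_imp_closed)
  have "continuous_on ({t0<..<t1} - S) v" using assms(3) by (rule continuous_on_subset) auto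
  then have "isCont v t" using o assms(2) by (simp add: continuous_on_eq_continuous_at)
  then show ?thesis by (simp add: isCont_def)
qed

text \<open>Off \<open>S\<close> continuity supplies both limits. Hence an exceptional set may be
  enlarged, which is required for sums, where the union of two such sets occurs.\<close>

lemma KC1_one_sided_limits:
  fixes v :: "real \<Rightarrow> 'a::real_normed_vector"
  assumes "finite S" "continuous_on ({t0..t1} - S) v"
    "\<And>s. s \<in> S \<Longrightarrow> \<exists>l. (v \<longlongrightarrow> l) (at_left s)"
    "\<And>s. s \<in> S \<Longrightarrow> \<exists>r. (v \<longlongrightarrow> r) (at_right s)"
    and "t \<in> {t0<..<t1}"
  shows "\<exists>l. (v \<longlongrightarrow> l) (at_left t)" "\<exists>r. (v \<longlongrightarrow> r) (at_right t)"
  using assms tendsto_of_continuous_off_finite[of S t t0 t1 v]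
  by (metis DiffI filterlim_at_split)+

lemma KC1_add:
  fixes x y :: "real \<Rightarrow> 'a::real_normed_vector"
  assumes t: "t0 < t1" and "x \<in> KC1 t0 t1" "y \<in> KC1 t0 t1"
  shows "(\<lambda>t. x t + y t) \<in> KC1 t0 t1"
proof -
  obtain S where S: "finite S" "S \<subseteq> {t0<..<t1}" "continuous_on {t0..t1} x"
    "\<And>t. t \<in> {t0..t1} - S \<Longrightarrow> x differentiable (at t within {t0..t1})"
    "continuous_on ({t0..t1} - S) (vel t0 t1 x)"
    "\<And>s. s \<in> S \<Longrightarrow> \<exists>l. (vel t0 t1 x \<longlongrightarrow> l) (at_left s)"
    "\<And>s. s \<in> S \<Longrightarrow> \<exists>r. (vel t0 t1 x \<longlongrightarrow> r) (at_right s)"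
    using KC1_E[OF assms(2)] by blast
  obtain R where R: "finite R" "R \<subseteq> {t0<..<t1}" "continuous_on {t0..t1} y"
    "\<And>t. t \<in> {t0..t1} - R \<Longrightarrow> y differentiable (at t within {t0..t1})"
    "continuous_on ({t0..t1} - R) (vel t0 t1 y)"
    "\<And>s. s \<in> R \<Longrightarrow> \<exists>l. (vel t0 t1 y \<longlongrightarrow> l) (at_left s)"
    "\<And>s. s \<in> R \<Longrightarrow> \<exists>r. (vel t0 t1 y \<longlongrightarrow> r) (at_right s)"
    using KC1_E[OF assms(3)] by blast
  let ?T = "S \<union> R"
  let ?v = "vel t0 t1 (\<lambda>t. x t + y t)" and ?w = "\<lambda>t. vel t0 t1 x t + vel t0 t1 y t"
  have v: "?v t = ?w t" if "t \<in> {t0..t1} - ?T" for t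
    using that by (intro vel_eqI[OF t] has_vector_derivative_add vel_works S(4) R(4)) auto
  have cont: "continuous_on ({t0..t1} - ?T) ?v"
  proof -
    have "continuous_on ({t0..t1} - ?T) ?w"
      by (intro continuous_on_add continuous_on_subset[OF S(5)] continuous_on_subset[OF R(5)]) auto
    then show ?thesis by (subst continuous_on_cong[OF refl v]) auto
  qed
  \<comment> \<open>At an exceptional point \<open>vel\<close> is unspecified and need not be
    additive. The two sides are therefore compared only on a punctured neighbourhood free of the
    other exceptional points, which is all that one-sided limits see.\<close>
  have ev: "eventually (\<lambda>t. ?w t = ?v t) (at s)" if "s \<in> ?T" for s
  proof -
    have "open ({t0<..<t1} - (?T - {s}))" using S(1) R(1)
      by (simp add: open_Diff finite_imp_closed)
    moreover have "s \<in> {t0<..<t1} - (?T - {s})" using that S(2) R(2) by auto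
    ultimately have "eventually (\<lambda>t. t \<in> {t0<..<t1} - (?T - {s})) (at s)"
      by (rule eventually_at_in_open')
    moreover have "eventually (\<lambda>t. t \<noteq> s) (at s)" by (simp add: eventually_neq_at_within)
    ultimately show ?thesis by eventually_elim (use v in auto)
  qed
  have lims: "\<exists>l. (?v \<longlongrightarrow> l) (at_left s)" "\<exists>r. (?v \<longlongrightarrow> r) (at_right s)" if "s \<in> ?T" for s
  proof -
    have s: "s \<in> {t0<..<t1}" using that S(2) R(2) by auto
    note ls = KC1_one_sided_limits[OF S(1,5,6,7) s] and lr = KC1_one_sided_limits[OF R(1,5,6,7) s]
    have e: "eventually (\<lambda>t. ?w t = ?v t) (at_left s)" "eventually (\<lambda>t. ?w t = ?v t) (at_right s)"
      using ev[OF that] by (auto simp: eventually_at_split)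
    from ls(1) lr(1) obtain l l' where "(vel t0 t1 x \<longlongrightarrow> l) (at_left s)" "(vel t0 t1 y \<longlongrightarrow> l') (at_left s)"
      by blast
    then have "(?w \<longlongrightarrow> l + l') (at_left s)" by (rule tendsto_add)
    then show "\<exists>l. (?v \<longlongrightarrow> l) (at_left s)" using Lim_transform_eventually e(1) by blast
    from ls(2) lr(2) obtain r r' where "(vel t0 t1 x \<longlongrightarrow> r) (at_right s)" "(vel t0 t1 y \<longlongrightarrow> r') (at_right s)"
      by blast
    then have "(?w \<longlongrightarrow> r + r') (at_right s)" by (rule tendsto_add)
    then show "\<exists>r. (?v \<longlongrightarrow> r) (at_right s)" using Lim_transform_eventually e(2) by blast
  qed
  show ?thesis
    unfolding KC1_def
  proof (intro CollectI conjI exI[of _ ?T] ballI)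
    show "continuous_on {t0..t1} (\<lambda>t. x t + y t)" using S(3) R(3) by (intro continuous_intros)
    show "finite ?T" "?T \<subseteq> {t0<..<t1}" using S R by auto
    show "(\<lambda>t. x t + y t) differentiable (at t within {t0..t1})" if "t \<in> {t0..t1} - ?T" for t
      using that S(4) R(4) by (intro differentiable_add) auto
  qed (use cont lims in auto)
qed

lemma has_vector_derivative_ramp:
  fixes z :: "'a::real_normed_vector"
  assumes "t \<noteq> p"
  shows "((\<lambda>t. max (t - p) 0 *\<^sub>R z) has_vector_derivative (if t < p then 0 else z)) (at t)"
proof (cases "t < p")
  case True
  have "((\<lambda>t. 0) has_vector_derivative 0) (at t)" by simp
  then have "((\<lambda>t. max (t - p) 0 *\<^sub>R z) has_vector_derivative 0) (at t)"
    by (rule has_vector_derivative_transform_within_open[where S="{..<p}"]) (use True in auto)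
  then show ?thesis using True by simp
next
  case False
  have "((\<lambda>t. (t - p) *\<^sub>R z) has_vector_derivative 1 *\<^sub>R z) (at t)"
    by (auto intro!: derivative_eq_intros)
  then have "((\<lambda>t. max (t - p) 0 *\<^sub>R z) has_vector_derivative 1 *\<^sub>R z) (at t)"
    by (rule has_vector_derivative_transform_within_open[where S="{p<..}"]) (use False assms in auto)
  then show ?thesis using False by simp
qed

text \<open>Membership depends only on the restriction to \<open>{t0..t1}\<close>, since
  \<open>vel\<close> differentiates within that interval. A function may thus be exchanged for a
  simpler one that differs from it elsewhere.\<close>

lemma KC1_cong:
  assumes "x \<in> KC1 t0 t1" "\<And>t. t \<in> {t0..t1} \<Longrightarrow> x t = y t"
  shows "y \<in> KC1 t0 t1"
proof -
  have d: "(x has_derivative D) (at t within {t0..t1}) = (y has_derivative D) (at t within {t0..t1})"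
    if "t \<in> {t0..t1}" for t D
    using that assms(2) by (metis has_derivative_transform)
  have v: "vel t0 t1 x t = vel t0 t1 y t" if "t \<in> {t0..t1}" for t
    unfolding vel_def vector_derivative_def has_vector_derivative_def using d[OF that] by simp
  obtain S where S: "finite S" "S \<subseteq> {t0<..<t1}" "continuous_on {t0..t1} x"
    "\<And>t. t \<in> {t0..t1} - S \<Longrightarrow> x differentiable (at t within {t0..t1})"
    "continuous_on ({t0..t1} - S) (vel t0 t1 x)"
    "\<And>s. s \<in> S \<Longrightarrow> \<exists>l. (vel t0 t1 x \<longlongrightarrow> l) (at_left s)"
    "\<And>s. s \<in> S \<Longrightarrow> \<exists>r. (vel t0 t1 x \<longlongrightarrow> r) (at_right s)"
    using KC1_E[OF assms(1)] by blast
  have ev: "eventually (\<lambda>t. vel t0 t1 x t = vel t0 t1 y t) (at s)" if "s \<in> S" for s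
    using eventually_at_in_open'[of "{t0<..<t1}" s] that S(2)
    by (force elim!: eventually_mono intro: v)
  have e: "eventually (\<lambda>t. vel t0 t1 x t = vel t0 t1 y t) (at_left s)"
    "eventually (\<lambda>t. vel t0 t1 x t = vel t0 t1 y t) (at_right s)" if "s \<in> S" for s
    using ev[OF that] by (auto simp: eventually_at_split)
  show ?thesis
    unfolding KC1_def
  proof (intro CollectI conjI exI[of _ S] ballI S(1,2))
    show "continuous_on {t0..t1} y" using S(3) assms(2) by (metis continuous_on_cong)
    show "y differentiable (at t within {t0..t1})" if "t \<in> {t0..t1} - S" for t
      using S(4)[OF that] d that unfolding differentiable_def by auto
    show "continuous_on ({t0..t1} - S) (vel t0 t1 y)"
      using S(5) v by (metis (mono_tags, lifting) continuous_on_cong DiffD1)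
    show "\<exists>l. (vel t0 t1 y \<longlongrightarrow> l) (at_left s)" if "s \<in> S" for s
      using S(6)[OF that] e(1)[OF that] Lim_transform_eventually by blast
    show "\<exists>r. (vel t0 t1 y \<longlongrightarrow> r) (at_right s)" if "s \<in> S" for s
      using S(7)[OF that] e(2)[OF that] Lim_transform_eventually by blast
  qed
qed

lemma KC1_ramp:
  fixes z :: "'a::real_normed_vector"
  assumes t: "t0 < t1"
  shows "(\<lambda>t. max (t - p) 0 *\<^sub>R z) \<in> KC1 t0 t1"
proof -
  have lin: "(\<lambda>t. (t - c) *\<^sub>R y) \<in> KC1 t0 t1" for c and y :: 'a
  proof -
    let ?f = "\<lambda>t. (t - c) *\<^sub>R y"
    have "(?f has_vector_derivative 1 *\<^sub>R y) (at t within {t0..t1})" for t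
      by (auto intro!: derivative_eq_intros)
    then have d: "(?f has_vector_derivative y) (at t within {t0..t1})" for t by simp
    have "vel t0 t1 ?f t = y" if "t \<in> {t0..t1}" for t
      using vel_eqI[OF t that d] .
    then have "y = vel t0 t1 ?f t" if "t \<in> {t0..t1}" for t using that by simp
    then have "continuous_on {t0..t1} (vel t0 t1 ?f)"
      by (rule continuous_on_eq[OF continuous_on_const])
    moreover have "?f differentiable (at t within {t0..t1})" for t
      using d by (rule differentiableI_vector)
    moreover have "continuous_on {t0..t1} ?f" by (intro continuous_intros)
    ultimately have "continuous_on {t0..t1} ?f \<and> finite {} \<and> {} \<subseteq> {t0<..<t1} \<and>
        (\<forall>t\<in>{t0..t1} - {}. ?f differentiable (at t within {t0..t1})) \<and>
        continuous_on ({t0..t1} - {}) (vel t0 t1 ?f) \<and>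
        (\<forall>s\<in>{}. (\<exists>l. (vel t0 t1 ?f \<longlongrightarrow> l) (at_left s)) \<and>
               (\<exists>r. (vel t0 t1 ?f \<longlongrightarrow> r) (at_right s)))" by simp
    then show ?thesis unfolding KC1_def by blast
  qed
  \<comment> \<open>Exceptional points must lie strictly inside the interval. A kink at an end point
    or beyond it is removed instead: on \<open>{t0..t1}\<close> the ramp then agrees with an affine
    function or with zero.\<close>
  consider "p \<le> t0" | "t1 \<le> p" | "p \<in> {t0<..<t1}"
    unfolding greaterThanLessThan_iff by linarith
  then show ?thesis
  proof cases
    case 1 then show ?thesis by (intro KC1_cong[OF lin[of p z]]) auto
  next
    case 2 then show ?thesis by (intro KC1_cong[OF lin[of p 0]]) auto
  next
    case 3
    let ?r = "\<lambda>t. max (t - p) 0 *\<^sub>R z"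
    note d = has_vector_derivative_ramp[where z=z and p=p]
    have v: "vel t0 t1 ?r t = (if t < p then 0 else z)" if "t \<in> {t0..t1} - {p}" for t
      using that by (intro vel_eqI[OF t] has_vector_derivative_at_within[OF d]) auto
    have evl: "eventually (\<lambda>t. 0 = vel t0 t1 ?r t) (at_left p)"
      by (rule eventually_mono[OF eventually_at_left_real[of t0 p]]) (use 3 v in auto)
    have evr: "eventually (\<lambda>t. z = vel t0 t1 ?r t) (at_right p)"
      by (rule eventually_mono[OF eventually_at_right_real[of p t1]]) (use 3 v in auto)
    have cont: "continuous_on ({t0..t1} - {p}) (vel t0 t1 ?r)"
    proof -
      have "continuous_on ({..<p} \<union> {p<..}) (\<lambda>t. if t < p then 0 else z)"
        by (intro continuous_on_open_Un continuous_on_eq[OF continuous_on_const[of _ 0]]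
            continuous_on_eq[OF continuous_on_const[of _ z]]) auto
      then have "continuous_on ({t0..t1} - {p}) (\<lambda>t. if t < p then 0 else z)"
        by (rule continuous_on_subset) auto
      then show ?thesis by (rule continuous_on_eq) (simp add: v)
    qed
    show ?thesis unfolding KC1_def
    proof (intro CollectI conjI exI[of _ "{p}"] ballI)
      show "?r differentiable (at t within {t0..t1})" if "t \<in> {t0..t1} - {p}" for t
        using that by (intro differentiableI_vector[OF has_vector_derivative_at_within[OF d]]) auto
      show "\<exists>l. (vel t0 t1 ?r \<longlongrightarrow> l) (at_left s)" if "s \<in> {p}" for s
        using Lim_transform_eventually[OF tendsto_const evl] that by blast
      show "\<exists>l. (vel t0 t1 ?r \<longlongrightarrow> l) (at_right s)" if "s \<in> {p}" for s
        using Lim_transform_eventually[OF tendsto_const evr] that by blast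
      show "continuous_on {t0..t1} ?r" by (intro continuous_intros)
    qed (use cont 3 in auto)
  qed
qed

section \<open>Bounded velocities, integrability along a curve, and gradients\<close>

lemma bounded_vel:
  fixes x :: "real \<Rightarrow> 'a::real_normed_vector"
  assumes t: "t0 < t1" and "x \<in> KC1 t0 t1"
  obtains M where "\<And>t. t \<in> {t0..t1} \<Longrightarrow> norm (vel t0 t1 x t) \<le> M"
proof -
  let ?v = "vel t0 t1 x"
  obtain S where S: "finite S" "S \<subseteq> {t0<..<t1}"
    "continuous_on ({t0..t1} - S) ?v"
    "\<And>s. s \<in> S \<Longrightarrow> \<exists>l. (?v \<longlongrightarrow> l) (at_left s)"
    "\<And>s. s \<in> S \<Longrightarrow> \<exists>r. (?v \<longlongrightarrow> r) (at_right s)"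
    using KC1_E[OF assms(2)] by metis
  define P where "P c d \<longleftrightarrow> (\<exists>M. \<forall>t\<in>{c..d} \<inter> {t0..t1}. norm (?v t) \<le> M)" for c d
  have lim_bd: "\<exists>M d. 0 < d \<and> (\<forall>t\<in>A. t \<noteq> s \<and> dist t s < d \<longrightarrow> norm (?v t) \<le> M)"
    if "(?v \<longlongrightarrow> l) (at s within A)" for l s A
  proof -
    have "eventually (\<lambda>t. dist (?v t) l < 1) (at s within A)" using that by (rule tendstoD) simp
    then obtain d where "0 < d" "\<forall>t\<in>A. t \<noteq> s \<and> dist t s < d \<longrightarrow> dist (?v t) l < 1"
      unfolding eventually_at by blast
    then have "\<forall>t\<in>A. t \<noteq> s \<and> dist t s < d \<longrightarrow> norm (?v t) \<le> norm l + 1"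
      by (smt (verit) dist_norm norm_triangle_sub)
    with \<open>0 < d\<close> show ?thesis by blast
  qed
  \<comment> \<open>Bisection argument: bounds on adjacent intervals combine, and near each point
    the limits of the velocity give a bound.\<close>
  from less_imp_le[OF t] have "P t0 t1"
  proof (induction rule: Bolzano)
    case (trans a b c)
    then obtain M M' where "\<forall>t\<in>{a..b} \<inter> {t0..t1}. norm (?v t) \<le> M"
      "\<forall>t\<in>{b..c} \<inter> {t0..t1}. norm (?v t) \<le> M'" unfolding P_def by auto
    then have "norm (?v t) \<le> max M M'" if "t \<in> {a..c} \<inter> {t0..t1}" for t
      using that by (cases "t \<le> b") (auto simp: le_max_iff_disj)
    then show ?case unfolding P_def by blast
  next
    case (local s)
    have "\<exists>M d. 0 < d \<and> (\<forall>t\<in>{t0..t1}. t \<noteq> s \<and> dist t s < d \<longrightarrow> norm (?v t) \<le> M)"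
    proof (cases "s \<in> S")
      case True
      from S(4)[OF this] obtain l where "(?v \<longlongrightarrow> l) (at_left s)" by blast
      from lim_bd[OF this] obtain M d where l: "0 < d" "\<forall>t\<in>{..<s}. t \<noteq> s \<and> dist t s < d \<longrightarrow> norm (?v t) \<le> M"
        by blast
      from S(5)[OF True] obtain r where "(?v \<longlongrightarrow> r) (at_right s)" by blast
      from lim_bd[OF this] obtain M' d' where r: "0 < d'" "\<forall>t\<in>{s<..}. t \<noteq> s \<and> dist t s < d' \<longrightarrow> norm (?v t) \<le> M'"
        by blast
      have "norm (?v t) \<le> max M M'" if "t \<noteq> s" "dist t s < min d d'" for t
        using l(2) r(2) that by (cases "t < s") (auto simp: le_max_iff_disj)
      then show ?thesis using l(1) r(1) by (intro exI[of _ "max M M'"] exI[of _ "min d d'"]) auto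
    next
      case False
      have "(?v \<longlongrightarrow> ?v s) (at s within {t0..t1} - S)"
        using S(3) False local by (auto simp: continuous_on_def)
      from lim_bd[OF this] obtain M d where d: "0 < d"
        "\<forall>t\<in>{t0..t1} - S. t \<noteq> s \<and> dist t s < d \<longrightarrow> norm (?v t) \<le> M" by blast
      \<comment> \<open>Continuity at \<open>s\<close> is relative to the complement of
        \<open>S\<close>; a radius that keeps away from the rest of \<open>S\<close> lifts this
        restriction.\<close>
      obtain e where e: "e > 0" "\<forall>t\<in>S. t \<noteq> s \<longrightarrow> e \<le> dist s t"
        using finite_set_avoid[OF S(1), of s] by blast
      have "norm (?v t) \<le> M" if "t \<in> {t0..t1}" "t \<noteq> s" "dist t s < min d e" for t
        using d(2) e(2) that by (auto simp: dist_commute)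
      then show ?thesis using d(1) e(1) by (intro exI[of _ M] exI[of _ "min d e"]) auto
    qed
    then obtain M d where d: "0 < d" "\<forall>t\<in>{t0..t1}. t \<noteq> s \<and> dist t s < d \<longrightarrow> norm (?v t) \<le> M"
      by blast
    \<comment> \<open>The limits say nothing about the value at \<open>s\<close> itself, which is
      unspecified at an angular point, so its norm enters the bound separately.\<close>
    have "P c c'" if "c \<le> s \<and> s \<le> c' \<and> c' - c < d" for c c'
      unfolding P_def
    proof (intro exI[of _ "max M (norm (?v s))"] ballI)
      fix t assume "t \<in> {c..c'} \<inter> {t0..t1}"
      then show "norm (?v t) \<le> max M (norm (?v s))"
        using d(2) that by (cases "t = s") (auto simp: dist_real_def le_max_iff_disj)
    qed
    then show ?case using d(1) by blast
  qed
  then obtain M where "\<forall>t\<in>{t0..t1} \<inter> {t0..t1}. norm (?v t) \<le> M" unfolding P_def by blast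
  then show ?thesis by (intro that[of M]) auto
qed

text \<open>Off the finite set of angular points the integrand is continuous, hence measurable. It
  is bounded because the triples of time, position and velocity stay in a compact set. The remaining
  points are negligible.\<close>

lemma integrable_along:
  fixes x :: "real \<Rightarrow> 'a::euclidean_space" and L :: "real \<times> 'a \<times> 'a \<Rightarrow> real"
  assumes t: "t0 < t1" and x: "x \<in> KC1 t0 t1"
    and L: "continuous_on \<Omega> L" "{t0..t1} \<times> UNIV \<times> UNIV \<subseteq> \<Omega>"
  shows "(\<lambda>t. L (t, x t, vel t0 t1 x t)) integrable_on {t0..t1}"
proof -
  let ?v = "vel t0 t1 x" and ?f = "\<lambda>t. L (t, x t, vel t0 t1 x t)"
  obtain S where S: "finite S" "continuous_on {t0..t1} x" "continuous_on ({t0..t1} - S) ?v"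
    using KC1_E[OF x] by metis
  obtain M where M: "\<And>t. t \<in> {t0..t1} \<Longrightarrow> norm (?v t) \<le> M" using bounded_vel[OF t x] by blast
  have "compact ({t0..t1} \<times> (x ` {t0..t1}) \<times> (cball 0 M :: 'a set))"
    by (intro compact_Times compact_continuous_image S(2) compact_cball compact_Icc)
  then have "bounded (L ` ({t0..t1} \<times> (x ` {t0..t1}) \<times> cball 0 M))"
    using L by (intro compact_imp_bounded compact_continuous_image continuous_on_subset[OF L(1)]) auto
  then obtain B where B: "\<And>p. p \<in> {t0..t1} \<times> (x ` {t0..t1}) \<times> cball 0 M \<Longrightarrow> norm (L p) \<le> B"
    unfolding bounded_iff by blast
  let ?A = "{t0..t1} - S"
  have A: "?A \<in> sets lebesgue" using S(1) by (auto intro!: sets.Diff simp: finite_imp_closed)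
  have neg: "negligible ((?A - {t0..t1}) \<union> ({t0..t1} - ?A))"
    by (rule negligible_subset[of S]) (use S(1) in auto)
  have "continuous_on ?A ?f"
    using L(2) by (intro continuous_on_compose2[OF L(1)] continuous_intros S(3) continuous_on_subset[OF S(2)]) auto
  then have "?f \<in> borel_measurable (lebesgue_on ?A)"
    using A by (rule continuous_imp_measurable_on_sets_lebesgue)
  moreover have "(\<lambda>t. B) integrable_on ?A"
    by (rule iffD2[OF integrable_spike_set_eq[OF neg] integrable_const_ivl])
  moreover have "norm (?f t) \<le> B" if "t \<in> ?A" for t using that M by (intro B) auto
  ultimately have "?f integrable_on ?A"
    using A by (rule measurable_bounded_by_integrable_imp_integrable)
  then show ?thesis by (rule iffD1[OF integrable_spike_set_eq[OF neg]])
qed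

text \<open>The vector \<open>adjoint f' 1\<close> represents \<open>f'\<close>, and uniqueness of
  the derivative makes it the only candidate, so the description in \<open>grad\<close> picks it
  out.\<close>

lemma inner_grad:
  fixes f :: "'a::euclidean_space \<Rightarrow> real"
  assumes "(f has_derivative f') (at x)"
  shows "grad f x \<bullet> y = f' y"
proof -
  have lin: "linear f'" using assms has_derivative_linear by blast
  have "f' = (\<lambda>h. h \<bullet> adjoint f' 1)"
    using adjoint_works[OF lin, of _ 1] by auto
  then have D: "GDERIV f x :> adjoint f' 1"
    using assms unfolding gderiv_def by simp
  have "grad f x = adjoint f' 1"
    unfolding grad_def
  proof (rule the_equality[where P="\<lambda>D. GDERIV f x :> D", OF D])
    fix D' assume "GDERIV f x :> D'"
    then have "(f has_derivative (\<lambda>h. h \<bullet> D')) (at x)" by (simp add: gderiv_def)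
    from has_derivative_unique[OF assms this] have "h \<bullet> D' = h \<bullet> adjoint f' 1" for h
      using adjoint_works[OF lin, of h 1] by simp
    then show "D' = adjoint f' 1" using vector_eq_ldot by blast
  qed
  then show ?thesis using adjoint_works[OF lin, of y 1] by (simp add: inner_commute)
qed

section \<open>Tent variations\<close>

text \<open>If \<open>(m - p) z + (q - m) z' = 0\<close>, this is the piecewise linear function supported on \<open>[p, q]\<close>
  with slope \<open>z\<close> on \<open>[p, m]\<close> and \<open>z'\<close> on \<open>[m, q]\<close>.\<close>
definition tent :: "real \<Rightarrow> real \<Rightarrow> real \<Rightarrow> 'a::real_vector \<Rightarrow> 'a \<Rightarrow> real \<Rightarrow> 'a" where
  "tent p m q z z' t = max (t - p) 0 *\<^sub>R z + max (t - m) 0 *\<^sub>R (z' - z) + max (t - q) 0 *\<^sub>R (- z')"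

lemma tent_KC1:
  fixes z :: "'a::real_normed_vector"
  assumes "t0 < t1"
  shows "tent p m q z z' \<in> KC1 t0 t1"
  using KC1_add[OF assms KC1_add[OF assms KC1_ramp[OF assms] KC1_ramp[OF assms]] KC1_ramp[OF assms],
      of p z m "z' - z" q "- z'"]
  by (simp add: tent_def[abs_def])

lemma tent_eq:
  fixes z :: "'a::real_normed_vector"
  assumes "p < m" "m < q" and bal: "(m - p) *\<^sub>R z + (q - m) *\<^sub>R z' = 0"
  shows "t \<le> p \<Longrightarrow> tent p m q z z' t = 0"
    and "p \<le> t \<Longrightarrow> t \<le> m \<Longrightarrow> tent p m q z z' t = (t - p) *\<^sub>R z"
    and "m \<le> t \<Longrightarrow> t \<le> q \<Longrightarrow> tent p m q z z' t = (t - q) *\<^sub>R z'"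
    and "q \<le> t \<Longrightarrow> tent p m q z z' t = 0"
proof -
  have e: "(t - p) *\<^sub>R z + (t - m) *\<^sub>R (z' - z) = (t - q) *\<^sub>R z'"
  proof -
    have "(t - p) *\<^sub>R z + (t - m) *\<^sub>R (z' - z) = (t - q) *\<^sub>R z' + ((m - p) *\<^sub>R z + (q - m) *\<^sub>R z')"
      by (simp add: algebra_simps)
    then show ?thesis using bal by simp
  qed
  show "t \<le> p \<Longrightarrow> tent p m q z z' t = 0" "p \<le> t \<Longrightarrow> t \<le> m \<Longrightarrow> tent p m q z z' t = (t - p) *\<^sub>R z"
    using assms(1,2) by (auto simp: tent_def)
  show "m \<le> t \<Longrightarrow> t \<le> q \<Longrightarrow> tent p m q z z' t = (t - q) *\<^sub>R z'" "q \<le> t \<Longrightarrow> tent p m q z z' t = 0"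
    using assms(1,2) e by (auto simp: tent_def)
qed

text \<open>The norm is largest at the apex \<open>m\<close>, and the closing condition says that
  both legs reach the same height there.\<close>

lemma norm_tent_le:
  fixes z :: "'a::real_normed_vector"
  assumes "p < m" "m < q" and bal: "(m - p) *\<^sub>R z + (q - m) *\<^sub>R z' = 0"
  shows "norm (tent p m q z z' t) \<le> (m - p) * norm z"
proof -
  note te = tent_eq[OF assms, of t]
  have "(q - m) *\<^sub>R z' = - ((m - p) *\<^sub>R z)" using bal by (simp add: eq_neg_iff_add_eq_0 add.commute)
  then have n: "(q - m) * norm z' = (m - p) * norm z"
    using assms(1,2) by (metis abs_of_pos diff_gt_0_iff_gt norm_minus_cancel norm_scaleR)
  have nn: "0 \<le> (m - p) * norm z" using assms by simp
  consider "t \<le> p" | "p \<le> t" "t \<le> m" | "m \<le> t" "t \<le> q" | "q \<le> t" by linarith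
  then show ?thesis
  proof cases
    case 2 then show ?thesis using te(2) by (auto intro: mult_right_mono)
  next
    case 3
    then have "norm (tent p m q z z' t) = (q - t) * norm z'" using te(3) by simp
    also have "\<dots> \<le> (q - m) * norm z'" using 3 by (intro mult_right_mono) auto
    finally show ?thesis using n by simp
  qed (use te nn in auto)
qed

lemma has_vector_derivative_tent:
  fixes z :: "'a::real_normed_vector"
  assumes "p < m" "m < q" "t \<notin> {p, m, q}"
  shows "(tent p m q z z' has_vector_derivative (if p < t \<and> t < m then z else if m < t \<and> t < q then z' else 0)) (at t)"
proof -
  have "(tent p m q z z' has_vector_derivative
     (if t < p then 0 else z) + (if t < m then 0 else z' - z) + (if t < q then 0 else - z')) (at t)"
    unfolding tent_def[abs_def] using assms(3)
    by (intro has_vector_derivative_add has_vector_derivative_ramp) auto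
  moreover have "(if t < p then 0 else z) + (if t < m then 0 else z' - z) + (if t < q then 0 else - z')
    = (if p < t \<and> t < m then z else if m < t \<and> t < q then z' else 0)"
    using assms by auto
  ultimately show ?thesis by simp
qed

section \<open>The increment of the functional along a tent\<close>

locale strong_extremal =
  fixes L :: "('n::finite) integrand"
    and L' :: "real \<times> (real ^ 'n) \<times> (real ^ 'n) \<Rightarrow> (real \<times> (real ^ 'n) \<times> (real ^ 'n)) \<Rightarrow>\<^sub>L real"
    and a b t0 t1 :: real
    and x0 x1 :: "real ^ 'n"
    and xb :: "real \<Rightarrow> real ^ 'n"
  assumes t01: "t0 < t1" and I: "{t0..t1} \<subseteq> {a<..<b}"
    and L': "\<And>p. p \<in> {a<..<b} \<times> UNIV \<times> UNIV \<Longrightarrow> (L has_derivative blinfun_apply (L' p)) (at p)"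
    and cont_L': "continuous_on ({a<..<b} \<times> UNIV \<times> UNIV) L'"
    and diff_L_v: "\<And>p. p \<in> {a<..<b} \<times> UNIV \<times> UNIV \<Longrightarrow> L_v L differentiable (at p)"
    and min: "strong_local_min L t0 t1 x0 x1 xb"
begin

lemma cont_L: "continuous_on ({a<..<b} \<times> UNIV \<times> UNIV) L"
  by (rule has_derivative_continuous_on[OF has_derivative_at_withinI[OF L']])

lemma inner_L_x:
  assumes "t \<in> {a<..<b}"
  shows "L_x L (t, x, v) \<bullet> y = L' (t, x, v) (0, y, 0)"
proof -
  have "((\<lambda>y. L (t, y, v)) has_derivative (\<lambda>h. L' (t, x, v) (0, h, 0))) (at x)"
    by (rule has_derivative_compose[where f="\<lambda>y. (t, y, v)", OF _ L'])
      (use assms in \<open>auto intro!: has_derivative_Pair\<close>)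
  then show ?thesis by (simp add: L_x_def inner_grad)
qed

lemma inner_L_v:
  assumes "t \<in> {a<..<b}"
  shows "L_v L (t, x, v) \<bullet> y = L' (t, x, v) (0, 0, y)"
proof -
  have "((\<lambda>w. L (t, x, w)) has_derivative (\<lambda>h. L' (t, x, v) (0, 0, h))) (at v)"
    by (rule has_derivative_compose[where f="\<lambda>w. (t, x, w)", OF _ L'])
      (use assms in \<open>auto intro!: has_derivative_Pair\<close>)
  then show ?thesis by (simp add: L_v_def inner_grad)
qed

lemma xb_KC1: "xb \<in> KC1 t0 t1"
  using min by (simp add: strong_local_min_def admissible_def)

text \<open>Here the minimum has to be a strong one: the radius \<delta> restricts only the height
  of the tent, so the slopes may be fixed and arbitrarily large while the support shrinks. Outside
  \<open>{p..q}\<close> the varied curve is the original one, so only the two legs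
  contribute.\<close>

lemma tent_variation_nonneg:
  obtains \<delta> where "\<delta> > 0" "\<And>p m q z z'. p < m \<Longrightarrow> m < q \<Longrightarrow> t0 \<le> p \<Longrightarrow> q \<le> t1 \<Longrightarrow>
    (m - p) *\<^sub>R z + (q - m) *\<^sub>R z' = 0 \<Longrightarrow> (m - p) * norm z \<le> \<delta> \<Longrightarrow>
    0 \<le> integral {p..m} (\<lambda>t. L (t, xb t + (t - p) *\<^sub>R z, vel t0 t1 xb t + z) - L (t, xb t, vel t0 t1 xb t))
      + integral {m..q} (\<lambda>t. L (t, xb t + (t - q) *\<^sub>R z', vel t0 t1 xb t + z') - L (t, xb t, vel t0 t1 xb t))"
proof -
  obtain \<delta> where "\<delta> > 0" and \<delta>: "\<And>x. admissible t0 t1 x0 x1 x \<Longrightarrow>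
      (SUP t\<in>{t0..t1}. norm (x t - xb t)) \<le> \<delta> \<Longrightarrow> J L t0 t1 x \<ge> J L t0 t1 xb"
    using min unfolding strong_local_min_def by blast
  show thesis
  proof (rule that[OF \<open>\<delta> > 0\<close>])
    fix p m q and z z' :: "real ^ 'n"
    assume pm: "p < m" and mq: "m < q" and tp: "t0 \<le> p" and qt: "q \<le> t1"
      and bal: "(m - p) *\<^sub>R z + (q - m) *\<^sub>R z' = 0" and small: "(m - p) * norm z \<le> \<delta>"
    let ?v = "vel t0 t1 xb"
    define h where "h = tent p m q z z'"
    define x where "x = (\<lambda>t. xb t + h t)"
    define F where "F t = L (t, x t, vel t0 t1 x t) - L (t, xb t, ?v t)" for t
    note h = tent_eq[OF pm mq bal, folded h_def]
    have x: "x \<in> KC1 t0 t1"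
      unfolding x_def h_def by (rule KC1_add[OF t01 xb_KC1 tent_KC1[OF t01]])
    have "admissible t0 t1 x0 x1 x"
      using min h(1)[of t0] h(4)[of t1] tp qt x
      by (simp add: strong_local_min_def admissible_def x_def)
    moreover have "(SUP t\<in>{t0..t1}. norm (x t - xb t)) \<le> \<delta>"
      using t01 norm_tent_le[OF pm mq bal] small unfolding x_def h_def
      by (intro cSUP_least) (auto intro: order_trans)
    ultimately have J: "J L t0 t1 x \<ge> J L t0 t1 xb" by (rule \<delta>)
    have \<Omega>: "{t0..t1} \<times> UNIV \<times> UNIV \<subseteq> {a<..<b} \<times> UNIV \<times> UNIV" using I by auto
    note int = integrable_along[OF t01 _ cont_L \<Omega>]
    have F: "F integrable_on {t0..t1}" unfolding F_def by (intro integrable_diff int x xb_KC1)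
    have "integral {t0..t1} F \<ge> 0"
      using J unfolding J_def F_def by (subst integral_diff[OF int[OF x] int[OF xb_KC1]]) simp
    moreover have "integral {t0..t1} F = integral {t0..p} F + integral {p..m} F + integral {m..q} F + integral {q..t1} F"
    proof -
      have sub: "F integrable_on {c..d}" if "t0 \<le> c" "d \<le> t1" for c d
        using integrable_on_subinterval[OF F] that by auto
      have "integral {c..d} F + integral {d..t1} F = integral {c..t1} F" if "t0 \<le> c" "c \<le> d" "d \<le> t1" for c d
        using that by (intro Henstock_Kurzweil_Integration.integral_combine sub) auto
      from this[of t0 p] this[of p m] this[of m q] show ?thesis using tp pm mq qt by simp
    qed
    moreover
    obtain S where S: "finite S" "\<And>t. t \<in> {t0..t1} - S \<Longrightarrow> xb differentiable (at t within {t0..t1})"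
      using KC1_E[OF xb_KC1] by metis
    \<comment> \<open>At angular points and at the kinks of the tent the velocity of the sum is
      unknown. They form a finite set, which the integrals ignore.\<close>
    define R where "R = S \<union> {p, m, q}"
    have R: "negligible R" unfolding R_def using S(1) by (intro negligible_finite) auto
    have vx: "vel t0 t1 x t = ?v t + (if p < t \<and> t < m then z else if m < t \<and> t < q then z' else 0)"
      if "t \<in> {t0..t1} - R" for t
      unfolding x_def h_def using that unfolding R_def
      by (intro vel_eqI[OF t01] has_vector_derivative_add vel_works S(2)
          has_vector_derivative_at_within[OF has_vector_derivative_tent] pm mq) auto
    have "integral {t0..p} F = integral {t0..p} (\<lambda>t. 0)"
      using tp pm mq qt vx h(1) by (intro integral_spike[OF R]) (auto simp: F_def x_def R_def)
    moreover have "integral {q..t1} F = integral {q..t1} (\<lambda>t. 0)"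
      using tp pm mq qt vx h(4) by (intro integral_spike[OF R]) (auto simp: F_def x_def R_def)
    moreover have "integral {p..m} F = integral {p..m} (\<lambda>t. L (t, xb t + (t - p) *\<^sub>R z, ?v t + z) - L (t, xb t, ?v t))"
      using tp pm mq qt vx h(2) by (intro integral_spike[OF R]) (auto simp: F_def x_def R_def)
    moreover have "integral {m..q} F = integral {m..q} (\<lambda>t. L (t, xb t + (t - q) *\<^sub>R z', ?v t + z') - L (t, xb t, ?v t))"
      using tp pm mq qt vx h(3) by (intro integral_spike[OF R]) (auto simp: F_def x_def R_def)
    ultimately show "0 \<le> integral {p..m} (\<lambda>t. L (t, xb t + (t - p) *\<^sub>R z, ?v t + z) - L (t, xb t, ?v t))
      + integral {m..q} (\<lambda>t. L (t, xb t + (t - q) *\<^sub>R z', ?v t + z') - L (t, xb t, ?v t))"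
      by simp
  qed
qed

end

section \<open>Integrals over short signed segments\<close>

text \<open>An integral over \<open>closed_segment c d\<close> ignores orientation whereas
  \<open>P d - P c\<close> changes sign with it; the factor \<open>sgn (d - c)\<close> reconciles
  them and also covers \<open>c = d\<close>.\<close>

lemma segment_integral_approx:
  fixes f P p :: "real \<Rightarrow> real"
  assumes f: "f integrable_on closed_segment c d"
    and P: "\<And>t. (P has_real_derivative p t) (at t)"
    and B: "\<And>t. t \<in> closed_segment c d \<Longrightarrow> \<bar>f t - p t\<bar> \<le> B"
  shows "\<bar>integral (closed_segment c d) f - sgn (d - c) * (P d - P c)\<bar> \<le> B * \<bar>d - c\<bar>"
proof -
  have main: "\<bar>integral {x..y} f - (P y - P x)\<bar> \<le> B * (y - x)"
    if "x \<le> y" "f integrable_on {x..y}" "\<And>t. t \<in> {x..y} \<Longrightarrow> \<bar>f t - p t\<bar> \<le> B" for x y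
  proof -
    have "(p has_integral (P y - P x)) {x..y}"
      using that(1) has_field_derivative_at_within[OF P] by (intro fundamental_theorem_of_calculus)
        (auto simp: has_real_derivative_iff_has_vector_derivative[symmetric])
    with that(2) have i: "((\<lambda>t. f t - p t) has_integral (integral {x..y} f - (P y - P x))) (cbox x y)"
      by (simp add: has_integral_diff integrable_integral)
    have "0 \<le> B" using that(3)[of x] that(1) by (meson abs_ge_zero atLeastAtMost_iff order.refl order_trans)
    from has_integral_bound[OF this i] show ?thesis using that by simp
  qed
  show ?thesis
  proof (cases "c < d")
    case True
    then show ?thesis using main[of c d] f B by (simp add: closed_segment_eq_real_ivl)
  next
    case False
    then have "\<bar>integral {d..c} f - (P c - P d)\<bar> \<le> B * (c - d)"
      using main[of d c] f B by (auto simp: closed_segment_eq_real_ivl split: if_splits)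
    with False show ?thesis
      by (cases "c = d") (auto simp: closed_segment_eq_real_ivl sgn_if abs_if)
  qed
qed

lemma closed_segment_sign_iff:
  fixes t :: real
  assumes "\<sigma> = 1 \<or> \<sigma> = -1" "c \<le> d"
  shows "t \<in> closed_segment (\<theta> + \<sigma> * c) (\<theta> + \<sigma> * d) \<longleftrightarrow> c \<le> \<sigma> * (t - \<theta>) \<and> \<sigma> * (t - \<theta>) \<le> d"
  using assms by (auto simp: closed_segment_eq_real_ivl)

lemma zero_le_mult_imp: "0 \<le> x * y \<Longrightarrow> 0 < x \<Longrightarrow> 0 \<le> y" for x y :: real
  by (simp add: zero_le_mult_iff)

text \<open>The factor \<open>\<sigma>\<close> in the conclusion is the orientation of the segments: their integrals are
  unoriented, whereas the approximating polynomials are integrated from \<open>\<theta>\<close> to \<open>\<theta> + \<sigma> * e\<close>.\<close>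
lemma tent_second_order:
  fixes f1 f2 :: "real \<Rightarrow> real \<Rightarrow> real"
  assumes \<sigma>: "\<sigma> = 1 \<or> \<sigma> = -1" and lam: "0 < lam" "lam < 1"
    and bal: "lam * a0 + (1 - lam) * b0 = 0"
    and approx: "\<And>\<rho>. \<rho> > 0 \<Longrightarrow> \<forall>\<^sub>F e in at_right 0.
      f1 e integrable_on closed_segment \<theta> (\<theta> + \<sigma> * (lam * e)) \<and>
      f2 e integrable_on closed_segment (\<theta> + \<sigma> * (lam * e)) (\<theta> + \<sigma> * e) \<and>
      (\<forall>t \<in> closed_segment \<theta> (\<theta> + \<sigma> * (lam * e)). \<bar>f1 e t - (a0 + a1 * (t - \<theta>))\<bar> \<le> \<rho> * e) \<and>
      (\<forall>t \<in> closed_segment (\<theta> + \<sigma> * (lam * e)) (\<theta> + \<sigma> * e).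
        \<bar>f2 e t - (b0 + b1 * (t - \<theta>) + b2 * (t - (\<theta> + \<sigma> * e)))\<bar> \<le> \<rho> * e) \<and>
      0 \<le> integral (closed_segment \<theta> (\<theta> + \<sigma> * (lam * e))) (f1 e)
        + integral (closed_segment (\<theta> + \<sigma> * (lam * e)) (\<theta> + \<sigma> * e)) (f2 e)"
  shows "0 \<le> \<sigma> * (lam\<^sup>2 * a1 + (1 - lam\<^sup>2) * b1 - (1 - lam)\<^sup>2 * b2)"
proof -
  define C where "C = lam\<^sup>2 * a1 + (1 - lam\<^sup>2) * b1 - (1 - lam)\<^sup>2 * b2"
  have ss: "\<sigma> * \<sigma> = 1" using \<sigma> by auto
  have "0 \<le> \<sigma> * C / 2 + \<rho>" if "\<rho> > 0" for \<rho>
  proof -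
    have "\<forall>\<^sub>F e in at_right (0::real). 0 < e" by (simp add: eventually_at_right_less)
    from eventually_happens'[OF trivial_limit_at_right_real eventually_conj[OF this approx[OF that]]]
    obtain e where e: "0 < e"
      and i1: "f1 e integrable_on closed_segment \<theta> (\<theta> + \<sigma> * (lam * e))"
      and i2: "f2 e integrable_on closed_segment (\<theta> + \<sigma> * (lam * e)) (\<theta> + \<sigma> * e)"
      and b1: "\<And>t. t \<in> closed_segment \<theta> (\<theta> + \<sigma> * (lam * e)) \<Longrightarrow> \<bar>f1 e t - (a0 + a1 * (t - \<theta>))\<bar> \<le> \<rho> * e"
      and b2: "\<And>t. t \<in> closed_segment (\<theta> + \<sigma> * (lam * e)) (\<theta> + \<sigma> * e) \<Longrightarrow>
        \<bar>f2 e t - (b0 + b1 * (t - \<theta>) + b2 * (t - (\<theta> + \<sigma> * e)))\<bar> \<le> \<rho> * e"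
      and nn: "0 \<le> integral (closed_segment \<theta> (\<theta> + \<sigma> * (lam * e))) (f1 e)
        + integral (closed_segment (\<theta> + \<sigma> * (lam * e)) (\<theta> + \<sigma> * e)) (f2 e)"
      by blast
    \<comment> \<open>Halved coefficients keep divisions out of the polynomial identities
      below.\<close>
    define A1 B1 B2 where "A1 = a1 / 2" "B1 = b1 / 2" "B2 = b2 / 2"
    then have half: "a1 = 2 * A1" "b1 = 2 * B1" "b2 = 2 * B2" by auto
    define P1 where "P1 t = a0 * t + A1 * (t - \<theta>)\<^sup>2" for t
    define P2 where "P2 t = b0 * t + B1 * (t - \<theta>)\<^sup>2 + B2 * (t - (\<theta> + \<sigma> * e))\<^sup>2" for t
    let ?m = "\<theta> + \<sigma> * (lam * e)" and ?q = "\<theta> + \<sigma> * e"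
    have d1: "(P1 has_real_derivative (a0 + a1 * (t - \<theta>))) (at t)" for t
      unfolding P1_def half by (rule derivative_eq_intros refl)+ (simp add: algebra_simps)
    have d2: "(P2 has_real_derivative (b0 + b1 * (t - \<theta>) + b2 * (t - (\<theta> + \<sigma> * e)))) (at t)" for t
      unfolding P2_def half by (rule derivative_eq_intros refl)+ (simp add: algebra_simps)
    have s1: "sgn (?m - \<theta>) = \<sigma>" "\<bar>?m - \<theta>\<bar> = lam * e"
      using \<sigma> lam e by (auto simp: sgn_mult abs_mult)
    have "?q - ?m = \<sigma> * ((1 - lam) * e)" by (simp add: algebra_simps)
    then have s2: "sgn (?q - ?m) = \<sigma>" "\<bar>?q - ?m\<bar> = (1 - lam) * e"
      using \<sigma> lam e by (auto simp: sgn_mult abs_mult)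
    have "integral (closed_segment \<theta> ?m) (f1 e) \<le> \<sigma> * (P1 ?m - P1 \<theta>) + \<rho> * e * (lam * e)"
      using segment_integral_approx[OF i1 d1 b1] unfolding s1 by linarith
    moreover have "integral (closed_segment ?m ?q) (f2 e) \<le> \<sigma> * (P2 ?q - P2 ?m) + \<rho> * e * ((1 - lam) * e)"
      using segment_integral_approx[OF i2 d2 b2] unfolding s2 by linarith
    ultimately have "0 \<le> \<sigma> * (P1 ?m - P1 \<theta>) + \<rho> * e * (lam * e) + (\<sigma> * (P2 ?q - P2 ?m) + \<rho> * e * ((1 - lam) * e))"
      using nn by linarith
    also have "\<dots> = \<sigma> * (P1 ?m - P1 \<theta> + (P2 ?q - P2 ?m)) + \<rho> * e\<^sup>2"
    proof -
      have "\<sigma> * X + \<rho> * e * (lam * e) + (\<sigma> * Y + \<rho> * e * ((1 - lam) * e)) = \<sigma> * (X + Y) + \<rho> * e\<^sup>2" for X Y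
        by (simp add: algebra_simps power2_eq_square)
      then show ?thesis .
    qed
    \<comment> \<open>The zeroth-order coefficients collect into the balance, which vanishes. The
      quadratic terms are the moments of the two legs, and \<open>\<sigma> * \<sigma> = 1\<close>
      makes them independent of the side.\<close>
    also have "P1 ?m - P1 \<theta> + (P2 ?q - P2 ?m) = \<sigma> * e * (lam * a0 + (1 - lam) * b0)
      + (\<sigma> * \<sigma>) * e\<^sup>2 * (lam\<^sup>2 * A1 + (1 - lam\<^sup>2) * B1 - (1 - lam)\<^sup>2 * B2)"
      unfolding P1_def P2_def by (simp add: power2_eq_square algebra_simps)
    also have "\<dots> = e\<^sup>2 * (C / 2)"
      unfolding ss bal half C_def by (simp add: algebra_simps)
    finally have "0 \<le> e\<^sup>2 * (\<sigma> * C / 2 + \<rho>)" by (simp add: algebra_simps)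
    moreover have "0 < e\<^sup>2" using e by simp
    ultimately show ?thesis by (rule zero_le_mult_imp)
  qed
  then have "0 \<le> \<sigma> * C / 2" by (rule field_le_epsilon)
  then show ?thesis unfolding C_def by simp
qed

text \<open>The same scheme one order lower: an error \<rho> integrates to
  \<open>\<rho> * e\<close>, and one division by \<open>e\<close> suffices. Orientation and
  displacement each contribute a factor \<sigma>, so none is left in the conclusion.\<close>

lemma tent_first_order:
  fixes f1 f2 :: "real \<Rightarrow> real \<Rightarrow> real"
  assumes \<sigma>: "\<sigma> = 1 \<or> \<sigma> = -1" and lam: "0 < lam" "lam < 1"
    and approx: "\<And>\<rho>. \<rho> > 0 \<Longrightarrow> \<forall>\<^sub>F e in at_right 0.
      f1 e integrable_on closed_segment \<theta> (\<theta> + \<sigma> * (lam * e)) \<and>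
      f2 e integrable_on closed_segment (\<theta> + \<sigma> * (lam * e)) (\<theta> + \<sigma> * e) \<and>
      (\<forall>t \<in> closed_segment \<theta> (\<theta> + \<sigma> * (lam * e)). \<bar>f1 e t - a0\<bar> \<le> \<rho>) \<and>
      (\<forall>t \<in> closed_segment (\<theta> + \<sigma> * (lam * e)) (\<theta> + \<sigma> * e). \<bar>f2 e t - b0\<bar> \<le> \<rho>) \<and>
      0 \<le> integral (closed_segment \<theta> (\<theta> + \<sigma> * (lam * e))) (f1 e)
        + integral (closed_segment (\<theta> + \<sigma> * (lam * e)) (\<theta> + \<sigma> * e)) (f2 e)"
  shows "0 \<le> lam * a0 + (1 - lam) * b0"
proof (rule field_le_epsilon)
  fix \<rho> :: real assume "\<rho> > 0"
  have ss: "\<sigma> * \<sigma> = 1" using \<sigma> by auto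
  have "\<forall>\<^sub>F e in at_right (0::real). 0 < e" by (simp add: eventually_at_right_less)
  from eventually_happens'[OF trivial_limit_at_right_real eventually_conj[OF this approx[OF \<open>\<rho> > 0\<close>]]]
  obtain e where e: "0 < e"
    and i1: "f1 e integrable_on closed_segment \<theta> (\<theta> + \<sigma> * (lam * e))"
    and i2: "f2 e integrable_on closed_segment (\<theta> + \<sigma> * (lam * e)) (\<theta> + \<sigma> * e)"
    and b1: "\<And>t. t \<in> closed_segment \<theta> (\<theta> + \<sigma> * (lam * e)) \<Longrightarrow> \<bar>f1 e t - a0\<bar> \<le> \<rho>"
    and b2: "\<And>t. t \<in> closed_segment (\<theta> + \<sigma> * (lam * e)) (\<theta> + \<sigma> * e) \<Longrightarrow> \<bar>f2 e t - b0\<bar> \<le> \<rho>"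
    and nn: "0 \<le> integral (closed_segment \<theta> (\<theta> + \<sigma> * (lam * e))) (f1 e)
      + integral (closed_segment (\<theta> + \<sigma> * (lam * e)) (\<theta> + \<sigma> * e)) (f2 e)"
    by blast
  let ?m = "\<theta> + \<sigma> * (lam * e)" and ?q = "\<theta> + \<sigma> * e"
  have d: "((\<lambda>t. c * t) has_real_derivative c) (at t)" for c t :: real
    by (auto intro!: derivative_eq_intros)
  have s1: "sgn (?m - \<theta>) = \<sigma>" "\<bar>?m - \<theta>\<bar> = lam * e"
    using \<sigma> lam e by (auto simp: sgn_mult abs_mult)
  have "?q - ?m = \<sigma> * ((1 - lam) * e)" by (simp add: algebra_simps)
  then have s2: "sgn (?q - ?m) = \<sigma>" "\<bar>?q - ?m\<bar> = (1 - lam) * e"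
    using \<sigma> lam e by (auto simp: sgn_mult abs_mult)
  have "integral (closed_segment \<theta> ?m) (f1 e) \<le> \<sigma> * (a0 * ?m - a0 * \<theta>) + \<rho> * (lam * e)"
    using segment_integral_approx[OF i1 d b1] unfolding s1 by linarith
  moreover have "integral (closed_segment ?m ?q) (f2 e) \<le> \<sigma> * (b0 * ?q - b0 * ?m) + \<rho> * ((1 - lam) * e)"
    using segment_integral_approx[OF i2 d b2] unfolding s2 by linarith
  ultimately have "0 \<le> \<sigma> * (a0 * ?m - a0 * \<theta>) + \<rho> * (lam * e) + (\<sigma> * (b0 * ?q - b0 * ?m) + \<rho> * ((1 - lam) * e))"
    using nn by linarith
  also have "\<dots> = (\<sigma> * \<sigma>) * e * (lam * a0 + (1 - lam) * b0) + \<rho> * e" by (simp add: algebra_simps)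
  finally have "0 \<le> e * (lam * a0 + (1 - lam) * b0 + \<rho>)" using ss by (simp add: algebra_simps)
  then show "0 \<le> lam * a0 + (1 - lam) * b0 + \<rho>" using e by (simp add: zero_le_mult_iff)
qed

lemma integrable_continuous_segment:
  fixes f :: "real \<Rightarrow> 'a::banach"
  assumes "continuous_on (closed_segment c d) f"
  shows "f integrable_on closed_segment c d"
  using assms by (auto simp: closed_segment_eq_real_ivl intro: integrable_continuous_real split: if_splits)

section \<open>The Weierstrass condition\<close>

text \<open>\<open>\<sigma> = 1\<close> stands for the right and \<open>\<sigma> = -1\<close> for the left side of \<open>\<theta>\<close>; \<open>w\<close> is the velocity with its
  value at \<open>\<theta>\<close> replaced by the limit from that side.\<close>
locale one_sided = strong_extremal +
  fixes \<theta> \<sigma> :: real and w :: "real \<Rightarrow> real ^ 'n"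
  assumes \<sigma>: "\<sigma> = 1 \<or> \<sigma> = -1"
    and \<theta>: "\<theta> \<in> {t0..t1}" and room: "\<sigma> = 1 \<Longrightarrow> \<theta> < t1" "\<sigma> = -1 \<Longrightarrow> t0 < \<theta>"
    and w: "\<And>t. t \<noteq> \<theta> \<Longrightarrow> w t = vel t0 t1 xb t"
    and w_tendsto: "(w \<longlongrightarrow> w \<theta>) (at \<theta> within {t. 0 \<le> \<sigma> * (t - \<theta>)})"
begin

lemma \<theta>_ab: "\<theta> \<in> {a<..<b}" using \<theta> I by auto

text \<open>Angular points other than \<theta> have a positive distance from it, and at \<theta>
  itself \<open>w\<close> carries the one-sided limit, so a short segment on the chosen side sees no
  discontinuity.\<close>

lemma eventually_segment:
  "\<forall>\<^sub>F e in at_right 0. 0 < e \<and> closed_segment \<theta> (\<theta> + \<sigma> * e) \<subseteq> {t0..t1} \<and>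
    continuous_on (closed_segment \<theta> (\<theta> + \<sigma> * e)) w"
proof -
  obtain S where S: "finite S" "continuous_on ({t0..t1} - S) (vel t0 t1 xb)"
    using KC1_E[OF xb_KC1] by metis
  obtain d where d: "d > 0" "\<forall>s\<in>S. s \<noteq> \<theta> \<longrightarrow> d \<le> dist \<theta> s"
    using finite_set_avoid[OF S(1), of \<theta>] by blast
  \<comment> \<open>The distance from \<theta> to the end of the interval on the chosen
    side.\<close>
  define r where "r = (if \<sigma> = 1 then t1 - \<theta> else \<theta> - t0)"
  have r: "r > 0" using room \<sigma> unfolding r_def by auto
  have "0 < e \<and> closed_segment \<theta> (\<theta> + \<sigma> * e) \<subseteq> {t0..t1} \<and> continuous_on (closed_segment \<theta> (\<theta> + \<sigma> * e)) w"
    if e: "0 < e" "e < min d r" for e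
  proof -
    let ?s = "closed_segment \<theta> (\<theta> + \<sigma> * e)"
    have mem: "t \<in> ?s \<longleftrightarrow> 0 \<le> \<sigma> * (t - \<theta>) \<and> \<sigma> * (t - \<theta>) \<le> e" for t
      using closed_segment_sign_iff[OF \<sigma>, of 0 e t \<theta>] e by simp
    have sub: "?s \<subseteq> {t0..t1}"
      using \<theta> e \<sigma> unfolding r_def by (auto simp: closed_segment_eq_real_ivl split: if_splits)
    have avoid: "t \<notin> S" if "t \<in> ?s" "t \<noteq> \<theta>" for t
    proof
      assume "t \<in> S"
      then have "d \<le> \<bar>\<theta> - t\<bar>" using d(2) that by (auto simp: dist_real_def)
      moreover have "\<bar>\<theta> - t\<bar> \<le> e" using that(1) \<sigma> unfolding mem by auto
      ultimately show False using e by simp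
    qed
    have c: "continuous_on ({t0..t1} - S - {\<theta>}) w"
      by (rule continuous_on_eq[OF continuous_on_subset[OF S(2)]]) (auto simp: w)
    have "continuous_on ?s w"
      unfolding continuous_on_def
    proof
      fix t assume t: "t \<in> ?s"
      show "(w \<longlongrightarrow> w t) (at t within ?s)"
      proof (cases "t = \<theta>")
        case True
        then show ?thesis using tendsto_within_subset[OF w_tendsto, of ?s] mem by auto
      next
        case False
        have "continuous_on (?s - {\<theta>}) w"
          by (rule continuous_on_subset[OF c]) (use sub avoid in auto)
        then have "(w \<longlongrightarrow> w t) (at t within ?s - {\<theta>})"
          using t False by (simp add: continuous_on_def)
        moreover have "at t within ?s - {\<theta>} = at t within ?s"
          by (rule at_within_nhd[where S="- {\<theta>}"]) (use False in auto)
        ultimately show ?thesis by simp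
      qed
    qed
    with e sub show ?thesis by blast
  qed
  then show ?thesis
    using d(1) r unfolding eventually_at_right_field by (intro exI[of _ "min d r"]) auto
qed

lemma one_sided_tent_nonneg:
  assumes lam: "0 < lam" "lam < 1"
  obtains \<delta> where "\<delta> > 0"
    "\<And>e z z'. 0 < e \<Longrightarrow> closed_segment \<theta> (\<theta> + \<sigma> * e) \<subseteq> {t0..t1} \<Longrightarrow> e * norm z \<le> \<delta> \<Longrightarrow>
      z' = (lam / (lam - 1)) *\<^sub>R z \<Longrightarrow>
      0 \<le> integral (closed_segment \<theta> (\<theta> + \<sigma> * (lam * e)))
            (\<lambda>t. L (t, xb t + (t - \<theta>) *\<^sub>R z, w t + z) - L (t, xb t, w t))
        + integral (closed_segment (\<theta> + \<sigma> * (lam * e)) (\<theta> + \<sigma> * e))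
            (\<lambda>t. L (t, xb t + (t - (\<theta> + \<sigma> * e)) *\<^sub>R z', w t + z') - L (t, xb t, w t))"
proof -
  obtain \<delta> where "\<delta> > 0" and \<delta>: "\<And>p m q z z'. p < m \<Longrightarrow> m < q \<Longrightarrow> t0 \<le> p \<Longrightarrow> q \<le> t1 \<Longrightarrow>
    (m - p) *\<^sub>R z + (q - m) *\<^sub>R z' = 0 \<Longrightarrow> (m - p) * norm z \<le> \<delta> \<Longrightarrow>
    0 \<le> integral {p..m} (\<lambda>t. L (t, xb t + (t - p) *\<^sub>R z, vel t0 t1 xb t + z) - L (t, xb t, vel t0 t1 xb t))
      + integral {m..q} (\<lambda>t. L (t, xb t + (t - q) *\<^sub>R z', vel t0 t1 xb t + z') - L (t, xb t, vel t0 t1 xb t))"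
    using tent_variation_nonneg by blast
  \<comment> \<open>\<open>w\<close> and the velocity differ at most at \<theta>, which has measure
    zero.\<close>
  have spike: "integral X (\<lambda>t. L (t, xb t + (t - c) *\<^sub>R z, vel t0 t1 xb t + z) - L (t, xb t, vel t0 t1 xb t))
      = integral X (\<lambda>t. L (t, xb t + (t - c) *\<^sub>R z, w t + z) - L (t, xb t, w t))" for X c z
    by (rule integral_spike[of "{\<theta>}"]) (auto simp: w)
  show thesis
  proof (rule that[OF \<open>\<delta> > 0\<close>])
    fix e and z z' :: "real ^ 'n"
    assume e: "0 < e" and sub: "closed_segment \<theta> (\<theta> + \<sigma> * e) \<subseteq> {t0..t1}" and small: "e * norm z \<le> \<delta>"
      and z': "z' = (lam / (lam - 1)) *\<^sub>R z"
    have le: "0 < lam * e" "lam * e < e" using lam e by auto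
    have ze: "((1 - lam) * e) *\<^sub>R z' = - ((lam * e) *\<^sub>R z)"
    proof -
      have "(1 - lam) * e * (lam / (lam - 1)) = - (lam * e)" using lam by (simp add: field_simps)
      then show ?thesis unfolding z' by simp
    qed
    have small': "lam * e * norm z \<le> \<delta>"
      using small le by (meson less_imp_le mult_right_mono norm_ge_zero order_trans)
    have nz: "((1 - lam) * e) * norm z' = lam * e * norm z"
      using arg_cong[OF ze, of norm] lam e by (simp add: abs_mult)
    have n': "((1 - lam) * e) * norm z' \<le> \<delta>" unfolding nz by (rule small')
    show "0 \<le> integral (closed_segment \<theta> (\<theta> + \<sigma> * (lam * e)))
            (\<lambda>t. L (t, xb t + (t - \<theta>) *\<^sub>R z, w t + z) - L (t, xb t, w t))
        + integral (closed_segment (\<theta> + \<sigma> * (lam * e)) (\<theta> + \<sigma> * e))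
            (\<lambda>t. L (t, xb t + (t - (\<theta> + \<sigma> * e)) *\<^sub>R z', w t + z') - L (t, xb t, w t))"
      using \<sigma>
    proof
      assume s: "\<sigma> = 1"
      have "t0 \<le> \<theta>" "\<theta> + e \<le> t1" using sub s e by (auto simp: closed_segment_eq_real_ivl)
      moreover have "(\<theta> + lam * e - \<theta>) *\<^sub>R z + (\<theta> + e - (\<theta> + lam * e)) *\<^sub>R z' = 0"
        using ze by (simp add: algebra_simps)
      ultimately show ?thesis
        using \<delta>[of \<theta> "\<theta> + lam * e" "\<theta> + e" z z'] le small' lam e
        unfolding spike by (simp add: s closed_segment_eq_real_ivl)
    next
      \<comment> \<open>Read in increasing time the tent now starts at \<open>\<theta> - e\<close>
        with slope \<open>z'\<close>, so the legs change roles and the height bound has to be stated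
        for \<open>z'\<close>.\<close>
      assume s: "\<sigma> = -1"
      have "t0 \<le> \<theta> - e" "\<theta> \<le> t1" using sub s e by (auto simp: closed_segment_eq_real_ivl split: if_splits)
      moreover have "(\<theta> - lam * e - (\<theta> - e)) *\<^sub>R z' + (\<theta> - (\<theta> - lam * e)) *\<^sub>R z = 0"
        using ze by (simp add: algebra_simps)
      moreover have "(\<theta> - lam * e - (\<theta> - e)) * norm z' \<le> \<delta>" using n' by (simp add: algebra_simps)
      moreover have seg: "closed_segment \<theta> (\<theta> + \<sigma> * (lam * e)) = {\<theta> - lam * e..\<theta>}"
        "closed_segment (\<theta> + \<sigma> * (lam * e)) (\<theta> + \<sigma> * e) = {\<theta> - e..\<theta> - lam * e}"
        using le s by (auto simp: closed_segment_eq_real_ivl)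
      ultimately show ?thesis
        using \<delta>[of "\<theta> - e" "\<theta> - lam * e" \<theta> z' z] le
        unfolding spike seg by (simp add: s add.commute)
    qed
  qed
qed

lemma sub_segment:
  assumes "0 < lam" "lam < 1" "0 < e"
  shows "closed_segment \<theta> (\<theta> + \<sigma> * (lam * e)) \<subseteq> closed_segment \<theta> (\<theta> + \<sigma> * e)"
    "closed_segment (\<theta> + \<sigma> * (lam * e)) (\<theta> + \<sigma> * e) \<subseteq> closed_segment \<theta> (\<theta> + \<sigma> * e)"
proof -
  have "lam * e \<le> e" "0 \<le> lam * e" "0 \<le> e" using assms by (auto intro: mult_left_le_one_le)
  then show "closed_segment \<theta> (\<theta> + \<sigma> * (lam * e)) \<subseteq> closed_segment \<theta> (\<theta> + \<sigma> * e)"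
    "closed_segment (\<theta> + \<sigma> * (lam * e)) (\<theta> + \<sigma> * e) \<subseteq> closed_segment \<theta> (\<theta> + \<sigma> * e)"
    using closed_segment_sign_iff[OF \<sigma>, of 0 e _ \<theta>] closed_segment_sign_iff[OF \<sigma>, of 0 "lam * e" _ \<theta>]
      closed_segment_sign_iff[OF \<sigma>, of "lam * e" e _ \<theta>] by auto
qed

lemma integrable_segment:
  assumes "closed_segment c d \<subseteq> {t0..t1}" "continuous_on (closed_segment c d) w"
  shows "(\<lambda>t. L (t, xb t + (t - q) *\<^sub>R z, w t + z) - L (t, xb t, w t)) integrable_on closed_segment c d"
proof (rule integrable_continuous_segment)
  have x: "continuous_on (closed_segment c d) xb"
    using KC1_E[OF xb_KC1] continuous_on_subset[OF _ assms(1)] by metis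
  show "continuous_on (closed_segment c d) (\<lambda>t. L (t, xb t + (t - q) *\<^sub>R z, w t + z) - L (t, xb t, w t))"
    using assms(1) I by (intro continuous_intros continuous_on_compose2[OF cont_L] assms(2) x) auto
qed

lemma segment_bounds:
  assumes "t \<in> closed_segment \<theta> (\<theta> + \<sigma> * e)" "0 < e"
  shows "0 \<le> \<sigma> * (t - \<theta>)" "\<sigma> * (t - \<theta>) \<le> e" "\<bar>t - \<theta>\<bar> \<le> e" "\<bar>t - (\<theta> + \<sigma> * e)\<bar> \<le> e"
proof -
  show *: "0 \<le> \<sigma> * (t - \<theta>)" "\<sigma> * (t - \<theta>) \<le> e"
    using assms closed_segment_sign_iff[OF \<sigma>, of 0 e t \<theta>] by auto
  show "\<bar>t - \<theta>\<bar> \<le> e" "\<bar>t - (\<theta> + \<sigma> * e)\<bar> \<le> e" using * \<sigma> by auto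
qed

lemma eventually_tent_nonneg:
  assumes lam: "0 < lam" "lam < 1" and z': "z' = (lam / (lam - 1)) *\<^sub>R z"
  shows "\<forall>\<^sub>F e in at_right 0.
      (\<lambda>t. L (t, xb t + (t - \<theta>) *\<^sub>R z, w t + z) - L (t, xb t, w t))
        integrable_on closed_segment \<theta> (\<theta> + \<sigma> * (lam * e)) \<and>
      (\<lambda>t. L (t, xb t + (t - (\<theta> + \<sigma> * e)) *\<^sub>R z', w t + z') - L (t, xb t, w t))
        integrable_on closed_segment (\<theta> + \<sigma> * (lam * e)) (\<theta> + \<sigma> * e) \<and>
      0 \<le> integral (closed_segment \<theta> (\<theta> + \<sigma> * (lam * e)))
            (\<lambda>t. L (t, xb t + (t - \<theta>) *\<^sub>R z, w t + z) - L (t, xb t, w t))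
        + integral (closed_segment (\<theta> + \<sigma> * (lam * e)) (\<theta> + \<sigma> * e))
            (\<lambda>t. L (t, xb t + (t - (\<theta> + \<sigma> * e)) *\<^sub>R z', w t + z') - L (t, xb t, w t))"
proof -
  obtain \<delta> where \<delta>: "\<delta> > 0"
    "\<And>e z z'. 0 < e \<Longrightarrow> closed_segment \<theta> (\<theta> + \<sigma> * e) \<subseteq> {t0..t1} \<Longrightarrow> e * norm z \<le> \<delta> \<Longrightarrow>
      z' = (lam / (lam - 1)) *\<^sub>R z \<Longrightarrow>
      0 \<le> integral (closed_segment \<theta> (\<theta> + \<sigma> * (lam * e)))
            (\<lambda>t. L (t, xb t + (t - \<theta>) *\<^sub>R z, w t + z) - L (t, xb t, w t))
        + integral (closed_segment (\<theta> + \<sigma> * (lam * e)) (\<theta> + \<sigma> * e))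
            (\<lambda>t. L (t, xb t + (t - (\<theta> + \<sigma> * e)) *\<^sub>R z', w t + z') - L (t, xb t, w t))"
    using one_sided_tent_nonneg[OF lam] by blast
  have sm: "\<forall>\<^sub>F e in at_right 0. e * norm z \<le> \<delta>"
  proof -
    have "((\<lambda>e. e * norm z) \<longlongrightarrow> 0 * norm z) (at_right 0)" by (intro tendsto_intros)
    from order_tendstoD(2)[OF this, of \<delta>] show ?thesis using \<delta>(1) by (auto elim: eventually_mono)
  qed
  show ?thesis
    using eventually_segment sm
  proof eventually_elim
    case (elim e)
    then have e: "0 < e" by blast
    note s = sub_segment[OF lam e]
    show ?case
      using elim s z' by (intro conjI integrable_segment \<delta>(2)[OF e]) (auto intro: continuous_on_subset)
  qed
qed

text \<open>The slopes stay fixed while the support shrinks, so the displacement tends to zero and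
  only the jumps of the velocity survive in the limit. Continuity of \<open>L\<close> controls the
  rest.\<close>

lemma Weierstrass_ineq_lam:
  assumes lam: "0 < lam" "lam < 1"
  shows "0 \<le> lam * (L (\<theta>, xb \<theta>, w \<theta> + z) - L (\<theta>, xb \<theta>, w \<theta>))
    + (1 - lam) * (L (\<theta>, xb \<theta>, w \<theta> + (lam / (lam - 1)) *\<^sub>R z) - L (\<theta>, xb \<theta>, w \<theta>))"
proof (rule tent_first_order[OF \<sigma> lam])
  fix \<rho> :: real assume \<rho>: "\<rho> > 0"
  let ?z' = "(lam / (lam - 1)) *\<^sub>R z"
  let ?T = "{t. 0 \<le> \<sigma> * (t - \<theta>)}"
  let ?F = "\<lambda>c t y. L (t, xb t + y, w t + c) - L (t, xb t, w t)"
  \<comment> \<open>The displacement is an independent variable \<open>y\<close>, so that joint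
    continuity in time and displacement covers both legs, although the second displacement depends
    on \<open>e\<close>.\<close>
  have near: "\<forall>\<^sub>F e in at_right 0. \<forall>t y. t \<in> closed_segment \<theta> (\<theta> + \<sigma> * e) \<longrightarrow> norm y \<le> e * norm c
      \<longrightarrow> \<bar>?F c t y - ?F c \<theta> 0\<bar> \<le> \<rho>" for c
  proof -
    obtain d where d: "d > 0" "closed_segment \<theta> (\<theta> + \<sigma> * d) \<subseteq> {t0..t1}"
      "continuous_on (closed_segment \<theta> (\<theta> + \<sigma> * d)) w"
      using eventually_happens'[OF trivial_limit_at_right_real eventually_segment] by blast
    let ?s = "closed_segment \<theta> (\<theta> + \<sigma> * d)"
    have x: "continuous_on ?s xb"
      using KC1_E[OF xb_KC1] continuous_on_subset[OF _ d(2)] by metis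
    have "continuous_on (?s \<times> UNIV) (\<lambda>z. ?F c (fst z) (snd z))"
      using d(2) I by (intro continuous_intros continuous_on_compose2[OF cont_L]
          continuous_on_compose2[OF d(3)] continuous_on_compose2[OF x]) auto
    moreover have "(\<theta>, 0) \<in> ?s \<times> UNIV" by simp
    ultimately obtain r where r: "r > 0"
      "\<And>z. z \<in> ?s \<times> UNIV \<Longrightarrow> dist z (\<theta>, 0) < r \<Longrightarrow> dist (?F c (fst z) (snd z)) (?F c \<theta> 0) < \<rho>"
      using \<rho> unfolding continuous_on_iff by (metis fst_conv snd_conv)
    \<comment> \<open>The pair \<open>(t, y)\<close> is within \<open>e + e * norm c\<close> of
      \<open>(\<theta>, 0)\<close>, which is below \<open>r\<close> for
      \<open>e < r / (2 + norm c)\<close>.\<close>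
    let ?k = "min d (r / (2 + norm c))"
    have np: "0 < 2 + norm c" by (simp add: add_pos_nonneg)
    have k: "?k > 0" using d(1) r(1) np by simp
    have "\<forall>t y. t \<in> closed_segment \<theta> (\<theta> + \<sigma> * e) \<longrightarrow> norm y \<le> e * norm c
      \<longrightarrow> \<bar>?F c t y - ?F c \<theta> 0\<bar> \<le> \<rho>" if e: "0 < e" "e < ?k" for e
    proof (intro allI impI)
      fix t and y :: "real ^ 'n"
      assume t: "t \<in> closed_segment \<theta> (\<theta> + \<sigma> * e)" and y: "norm y \<le> e * norm c"
      note te = segment_bounds[OF t e(1)]
      then have "t \<in> ?s" using closed_segment_sign_iff[OF \<sigma>, of 0 d t \<theta>] e d(1) by auto
      moreover from te(3) have "dist (t, y) (\<theta>, 0) \<le> e + e * norm c"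
        using norm_Pair_le[of "t - \<theta>" y] y by (simp add: dist_norm)
      moreover have "e + e * norm c < r"
      proof -
        have "e * (2 + norm c) < r" using e np by (simp add: pos_less_divide_eq)
        then show ?thesis using e by (simp add: algebra_simps)
      qed
      ultimately show "\<bar>?F c t y - ?F c \<theta> 0\<bar> \<le> \<rho>"
        using r(2)[of "(t, y)"] by (simp add: dist_real_def)
    qed
    then show ?thesis using k unfolding eventually_at_right_field by (intro exI[of _ ?k]) auto
  qed
  show "\<forall>\<^sub>F e in at_right 0.
      (\<lambda>t. ?F z t ((t - \<theta>) *\<^sub>R z)) integrable_on closed_segment \<theta> (\<theta> + \<sigma> * (lam * e)) \<and>
      (\<lambda>t. ?F ?z' t ((t - (\<theta> + \<sigma> * e)) *\<^sub>R ?z')) integrable_on closed_segment (\<theta> + \<sigma> * (lam * e)) (\<theta> + \<sigma> * e) \<and>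
      (\<forall>t \<in> closed_segment \<theta> (\<theta> + \<sigma> * (lam * e)).
        \<bar>?F z t ((t - \<theta>) *\<^sub>R z) - (L (\<theta>, xb \<theta>, w \<theta> + z) - L (\<theta>, xb \<theta>, w \<theta>))\<bar> \<le> \<rho>) \<and>
      (\<forall>t \<in> closed_segment (\<theta> + \<sigma> * (lam * e)) (\<theta> + \<sigma> * e).
        \<bar>?F ?z' t ((t - (\<theta> + \<sigma> * e)) *\<^sub>R ?z') - (L (\<theta>, xb \<theta>, w \<theta> + ?z') - L (\<theta>, xb \<theta>, w \<theta>))\<bar> \<le> \<rho>) \<and>
      0 \<le> integral (closed_segment \<theta> (\<theta> + \<sigma> * (lam * e))) (\<lambda>t. ?F z t ((t - \<theta>) *\<^sub>R z))
        + integral (closed_segment (\<theta> + \<sigma> * (lam * e)) (\<theta> + \<sigma> * e)) (\<lambda>t. ?F ?z' t ((t - (\<theta> + \<sigma> * e)) *\<^sub>R ?z'))"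
    using eventually_segment eventually_tent_nonneg[OF lam refl, of z] near[of z] near[of ?z']
  proof eventually_elim
    case (elim e)
    then have e: "0 < e" by blast
    note s = sub_segment[OF lam e]
    have dist: "norm ((t - \<theta>) *\<^sub>R c) \<le> e * norm c" "norm ((t - (\<theta> + \<sigma> * e)) *\<^sub>R c) \<le> e * norm c"
      if "t \<in> closed_segment \<theta> (\<theta> + \<sigma> * e)" for t and c :: "real ^ 'n"
      using segment_bounds(3,4)[OF that e] by (auto intro: mult_right_mono)
    show ?case
    proof (intro conjI ballI)
      fix t assume "t \<in> closed_segment \<theta> (\<theta> + \<sigma> * (lam * e))"
      with s have t: "t \<in> closed_segment \<theta> (\<theta> + \<sigma> * e)" by blast
      with elim dist(1)[OF t, of z] show "\<bar>?F z t ((t - \<theta>) *\<^sub>R z) - (L (\<theta>, xb \<theta>, w \<theta> + z) - L (\<theta>, xb \<theta>, w \<theta>))\<bar> \<le> \<rho>"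
        by simp
    next
      fix t assume "t \<in> closed_segment (\<theta> + \<sigma> * (lam * e)) (\<theta> + \<sigma> * e)"
      with s have t: "t \<in> closed_segment \<theta> (\<theta> + \<sigma> * e)" by blast
      with elim dist(2)[OF t, of ?z'] show "\<bar>?F ?z' t ((t - (\<theta> + \<sigma> * e)) *\<^sub>R ?z') - (L (\<theta>, xb \<theta>, w \<theta> + ?z') - L (\<theta>, xb \<theta>, w \<theta>))\<bar> \<le> \<rho>"
        by simp
    qed (use elim in auto)
  qed
qed

text \<open>With \<open>\<mu> = lam / (1 - lam)\<close> the preceding inequality is a difference quotient bound; let \<open>\<mu> \<rightarrow> 0\<close>.\<close>
lemma Weierstrass: "0 \<le> E L xb w \<theta> z"
proof -
  let ?p = "(\<theta>, xb \<theta>, w \<theta>)"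
  let ?g = "\<lambda>\<mu>. L (\<theta>, xb \<theta>, w \<theta> + \<mu> *\<^sub>R z)"
  let ?a = "L (\<theta>, xb \<theta>, w \<theta> + z) - L ?p"
  have D: "(?g has_real_derivative (L_v L ?p \<bullet> z)) (at 0)"
  proof -
    have "((\<lambda>\<mu>. (\<theta>, xb \<theta>, w \<theta> + \<mu> *\<^sub>R z)) has_derivative (\<lambda>h. (0, 0, h *\<^sub>R z))) (at 0)"
      by (auto intro!: has_derivative_Pair derivative_eq_intros)
    moreover have "(L has_derivative L' ?p) (at (\<theta>, xb \<theta>, w \<theta> + 0 *\<^sub>R z))" using L'[of ?p] \<theta>_ab by simp
    ultimately have "(?g has_derivative (\<lambda>h. L' ?p (0, 0, h *\<^sub>R z))) (at 0)"
      by (rule has_derivative_compose)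
    moreover have "(\<lambda>h. L' ?p (0, 0, h *\<^sub>R z)) = (*) (L_v L ?p \<bullet> z)"
      using inner_L_v[OF \<theta>_ab, of "xb \<theta>" "w \<theta>" "h *\<^sub>R z" for h] by (auto simp: mult.commute)
    ultimately show ?thesis by (simp add: has_field_derivative_def)
  qed
  have *: "(?g (- \<mu>) - ?g 0) / (- \<mu>) \<le> ?a" if "\<mu> > 0" for \<mu>
  proof -
    \<comment> \<open>This solves \<open>\<mu> = lam / (1 - lam)\<close>, so that the second slope
      is exactly \<open>- \<mu>\<close> times \<open>z\<close>.\<close>
    define lam where "lam = \<mu> / (1 + \<mu>)"
    have lam: "0 < lam" "lam < 1" "1 - lam > 0" using that by (auto simp: lam_def)
    have m: "lam / (lam - 1) = - \<mu>" and l: "lam = (1 - lam) * \<mu>" using that by (auto simp: lam_def field_simps)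
    have "0 \<le> lam * ?a + (1 - lam) * (?g (- \<mu>) - ?g 0)"
      using Weierstrass_ineq_lam[OF lam(1,2), of z] unfolding m by simp
    also have "lam * ?a = (1 - lam) * \<mu> * ?a" using l by simp
    also have "(1 - lam) * \<mu> * ?a + (1 - lam) * (?g (- \<mu>) - ?g 0) = (1 - lam) * (\<mu> * ?a + (?g (- \<mu>) - ?g 0))"
      by (simp only: distrib_left mult.assoc)
    finally have "0 \<le> (1 - lam) * (\<mu> * ?a + (?g (- \<mu>) - ?g 0))" .
    then have "0 \<le> \<mu> * ?a + (?g (- \<mu>) - ?g 0)" using lam by (simp add: zero_le_mult_iff)
    then show ?thesis using that by (simp add: field_simps)
  qed
  \<comment> \<open>The second slope is a negative multiple of \<open>z\<close>, so the quotients
    are bounded only for negative increments; their limit is still the full derivative.\<close>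
  have "((\<lambda>h. (?g (0 + h) - ?g 0) / h) \<longlongrightarrow> L_v L ?p \<bullet> z) (at_left 0)"
    using D unfolding DERIV_def by (rule filterlim_mono[OF _ order_refl]) (simp add: at_le)
  moreover have "\<forall>\<^sub>F h in at_left 0. (?g (0 + h) - ?g 0) / h \<le> ?a"
    unfolding eventually_at_left_field using *[of "- h" for h] by (intro exI[of _ "-1"]) auto
  ultimately have "L_v L ?p \<bullet> z \<le> ?a"
    by (intro tendsto_upperbound[where F="at_left (0::real)"]) auto
  then show ?thesis by (simp add: E_def)
qed

end

section \<open>The one-sided Euler equation\<close>

text \<open>Differentiability of the curve and of its velocity is recorded at \<theta> alone and
  from one side, separately from \<open>one_sided\<close>, because the Weierstrass condition is
  later applied at neighbouring points where the velocity is merely continuous.\<close>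

locale smooth_one_sided = one_sided +
  fixes A :: "real ^ 'n"
  assumes xb': "(xb has_vector_derivative w \<theta>) (at \<theta> within {t. 0 \<le> \<sigma> * (t - \<theta>)})"
    and w': "(w has_vector_derivative A) (at \<theta> within {t. 0 \<le> \<sigma> * (t - \<theta>)})"
begin

abbreviation "T \<equiv> {t. 0 \<le> \<sigma> * (t - \<theta>)}"

lemma eventually_one_sided:
  assumes "\<forall>\<^sub>F t in at \<theta> within T. P t" "P \<theta>"
  shows "\<forall>\<^sub>F e in at_right 0. \<forall>t. 0 \<le> \<sigma> * (t - \<theta>) \<longrightarrow> \<bar>t - \<theta>\<bar> \<le> e \<longrightarrow> P t"
proof -
  obtain d where d: "d > 0" "\<And>t. t \<in> T \<Longrightarrow> t \<noteq> \<theta> \<Longrightarrow> dist t \<theta> < d \<Longrightarrow> P t"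
    using assms(1) unfolding eventually_at by blast
  have "P t" if "0 \<le> \<sigma> * (t - \<theta>)" "\<bar>t - \<theta>\<bar> \<le> e" "e < d" for t e
    using d(2)[of t] that assms(2) by (cases "t = \<theta>") (auto simp: dist_real_def)
  then show ?thesis
    using d(1) unfolding eventually_at_right_field by (intro exI[of _ d]) blast
qed

lemma has_derivative_path:
  "((\<lambda>t. (t, xb t, w t + c)) has_derivative (\<lambda>h. h *\<^sub>R (1, w \<theta>, A))) (at \<theta> within T)"
proof -
  have "((\<lambda>t. w t + c) has_derivative (\<lambda>h. h *\<^sub>R A + 0)) (at \<theta> within T)"
    using w' unfolding has_vector_derivative_def by (intro has_derivative_add has_derivative_const)
  moreover have "(xb has_derivative (\<lambda>h. h *\<^sub>R w \<theta>)) (at \<theta> within T)"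
    using xb' unfolding has_vector_derivative_def .
  ultimately have "((\<lambda>t. (t, xb t, w t + c)) has_derivative (\<lambda>h. (h, h *\<^sub>R w \<theta>, h *\<^sub>R A + 0))) (at \<theta> within T)"
    by (intro has_derivative_Pair has_derivative_ident)
  then show ?thesis by simp
qed

text \<open>Differentiability at one point already gives an error that is uniform over all
  displacements of size \<open>O(e)\<close>. As \<open>y\<close> is free, one expansion serves
  either leg and, with \<open>y = 0\<close>, the unperturbed curve.\<close>

lemma L_expansion:
  obtains D where "((\<lambda>t. L (t, xb t, w t + c)) has_real_derivative D) (at \<theta> within T)"
    "\<And>K \<rho>. 0 \<le> K \<Longrightarrow> 0 < \<rho> \<Longrightarrow> \<forall>\<^sub>F e in at_right 0. \<forall>t y. 0 \<le> \<sigma> * (t - \<theta>) \<longrightarrow> \<bar>t - \<theta>\<bar> \<le> e \<longrightarrow> norm y \<le> e * K \<longrightarrow>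
      \<bar>L (t, xb t + y, w t + c) - (L (\<theta>, xb \<theta>, w \<theta> + c) + D * (t - \<theta>) + L_x L (\<theta>, xb \<theta>, w \<theta> + c) \<bullet> y)\<bar> \<le> \<rho> * e"
proof -
  let ?p = "(\<theta>, xb \<theta>, w \<theta> + c)"
  define D where "D = L' ?p (1, w \<theta>, A)"
  have Lp: "(L has_derivative L' ?p) (at ?p)" using L'[of ?p] \<theta>_ab by simp
  have "((\<lambda>t. L (t, xb t, w t + c)) has_derivative (\<lambda>h. L' ?p (h *\<^sub>R (1, w \<theta>, A)))) (at \<theta> within T)"
    by (rule has_derivative_compose[OF has_derivative_path Lp])
  then have D: "((\<lambda>t. L (t, xb t, w t + c)) has_real_derivative D) (at \<theta> within T)"
    unfolding has_field_derivative_def blinfun.scaleR_right D_def by (simp add: mult_commute_abs)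
  \<comment> \<open>Time is restricted to the side of \<theta>, while the displacement ranges over
    the whole space; the derivative is taken jointly at \<open>(\<theta>, 0)\<close>.\<close>
  let ?S = "T \<times> (UNIV :: (real ^ 'n) set)"
  have "((\<lambda>z. (fst z, xb (fst z), w (fst z) + c) + (0, snd z, 0)) has_derivative
      (\<lambda>h. fst h *\<^sub>R (1, w \<theta>, A) + (0, snd h, 0))) (at (\<theta>, 0) within ?S)"
  proof (rule has_derivative_add)
    have "((\<lambda>t. (t, xb t, w t + c)) has_derivative (\<lambda>h. h *\<^sub>R (1, w \<theta>, A))) (at (fst (\<theta>, 0 :: real ^ 'n)) within fst ` ?S)"
      using has_derivative_path by simp
    then show "((\<lambda>z. (fst z, xb (fst z), w (fst z) + c)) has_derivative (\<lambda>h. fst h *\<^sub>R (1, w \<theta>, A))) (at (\<theta>, 0) within ?S)"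
      by (rule has_derivative_in_compose[rotated]) (intro derivative_intros)
  qed (intro has_derivative_Pair has_derivative_const derivative_intros)
  then have "((\<lambda>z. L ((fst z, xb (fst z), w (fst z) + c) + (0, snd z, 0))) has_derivative
      (\<lambda>h. L' ?p (fst h *\<^sub>R (1, w \<theta>, A) + (0, snd h, 0)))) (at (\<theta>, 0) within ?S)"
    by (rule has_derivative_compose) (use Lp in simp)
  then have alt: "\<forall>e>0. \<exists>d>0. \<forall>z\<in>?S. norm (z - (\<theta>, 0)) < d \<longrightarrow>
      norm (L ((fst z, xb (fst z), w (fst z) + c) + (0, snd z, 0)) - L ?p
        - L' ?p (fst (z - (\<theta>, 0)) *\<^sub>R (1, w \<theta>, A) + (0, snd (z - (\<theta>, 0)), 0))) \<le> e * norm (z - (\<theta>, 0))"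
    unfolding has_derivative_within_alt by simp
  have lin: "L' ?p (h *\<^sub>R (1, w \<theta>, A) + (0, y, 0)) = D * h + L_x L ?p \<bullet> y" for h y
    unfolding blinfun.add_right blinfun.scaleR_right D_def inner_L_x[OF \<theta>_ab] by simp
  have "\<forall>\<^sub>F e in at_right 0. \<forall>t y. 0 \<le> \<sigma> * (t - \<theta>) \<longrightarrow> \<bar>t - \<theta>\<bar> \<le> e \<longrightarrow> norm y \<le> e * K \<longrightarrow>
      \<bar>L (t, xb t + y, w t + c) - (L ?p + D * (t - \<theta>) + L_x L ?p \<bullet> y)\<bar> \<le> \<rho> * e"
    if K: "0 \<le> K" and \<rho>: "0 < \<rho>" for K \<rho>
  proof -
    have K1: "0 < 1 + K" using K by simp
    \<comment> \<open>The pair \<open>(t - \<theta>, y)\<close> has norm at most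
      \<open>e * (1 + K)\<close>, so this relative error amounts to
      \<open>\<rho> * e\<close>.\<close>
    then have "0 < \<rho> / (1 + K)" using \<rho> by simp
    then obtain d where d: "d > 0" "\<forall>z\<in>?S. norm (z - (\<theta>, 0)) < d \<longrightarrow>
      norm (L ((fst z, xb (fst z), w (fst z) + c) + (0, snd z, 0)) - L ?p
        - L' ?p (fst (z - (\<theta>, 0)) *\<^sub>R (1, w \<theta>, A) + (0, snd (z - (\<theta>, 0)), 0))) \<le> \<rho> / (1 + K) * norm (z - (\<theta>, 0))"
      using alt by blast
    have "\<bar>L (t, xb t + y, w t + c) - (L ?p + D * (t - \<theta>) + L_x L ?p \<bullet> y)\<bar> \<le> \<rho> * e"
      if "0 \<le> \<sigma> * (t - \<theta>)" "\<bar>t - \<theta>\<bar> \<le> e" "norm y \<le> e * K" and e: "0 < e" "e < d / (1 + K)" for t y e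
    proof -
      have n: "norm ((t, y) - (\<theta>, 0)) \<le> e * (1 + K)"
        using norm_Pair_le[of "t - \<theta>" y] that(2,3) by (simp add: algebra_simps)
      moreover have "e * (1 + K) < d" using e(2) K1 by (simp add: pos_less_divide_eq)
      ultimately have "norm (L (t, xb t + y, w t + c) - L ?p - L' ?p ((t - \<theta>) *\<^sub>R (1, w \<theta>, A) + (0, y, 0)))
        \<le> \<rho> / (1 + K) * norm ((t, y) - (\<theta>, 0))"
        using d(2)[rule_format, of "(t, y)"] that(1) by (simp del: scaleR_Pair)
      also have "\<dots> \<le> \<rho> / (1 + K) * (e * (1 + K))" using n \<rho> K1 by (intro mult_left_mono) auto
      also have "\<dots> = \<rho> * e" using K1 by simp
      finally show ?thesis unfolding lin by (simp add: algebra_simps)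
    qed
    then show ?thesis
      using d(1) K1 unfolding eventually_at_right_field by (intro exI[of _ "d / (1 + K)"]) auto
  qed
  with D show thesis by (rule that)
qed

text \<open>The amplitude \<open>s\<close> scales slope and displacement together; continuity of
  \<open>L'\<close> justifies differentiation under the integral sign.\<close>

lemma segment_first_variation:
  assumes sub: "closed_segment c d \<subseteq> {t0..t1}" and cw: "continuous_on (closed_segment c d) w"
  shows "((\<lambda>s. integral (closed_segment c d)
      (\<lambda>t. L (t, xb t + (t - q) *\<^sub>R (s *\<^sub>R z), w t + s *\<^sub>R z) - L (t, xb t, w t)))
    has_real_derivative
      integral (closed_segment c d) (\<lambda>t. L' (t, xb t, w t) (0, (t - q) *\<^sub>R z, z))) (at 0)"
proof -
  obtain c' d' where cd: "closed_segment c d = cbox c' d'"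
    by (metis box_real(2) closed_segment_eq_real_ivl)
  have ab: "t \<in> {a<..<b}" if "t \<in> closed_segment c d" for t using sub that I by auto
  have x: "continuous_on (closed_segment c d) xb"
    using KC1_E[OF xb_KC1] continuous_on_subset[OF _ sub] by metis
  let ?path = "\<lambda>s t. (t, xb t + (t - q) *\<^sub>R (s *\<^sub>R z), w t + s *\<^sub>R z)"
  let ?f = "\<lambda>s t. L (?path s t) - L (t, xb t, w t)"
  let ?fx = "\<lambda>s t. L' (?path s t) (0, (t - q) *\<^sub>R z, z)"
  have "((\<lambda>s. integral (cbox c' d') (?f s)) has_field_derivative integral (cbox c' d') (?fx 0)) (at 0 within UNIV)"
  proof (rule leibniz_rule_field_derivative[where f = ?f and fx = ?fx])
    fix s t assume "t \<in> cbox c' d'"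
    then have t: "t \<in> {a<..<b}" using ab cd by auto
    have "((\<lambda>s. ?path s t) has_derivative (\<lambda>h. h *\<^sub>R (0, (t - q) *\<^sub>R z, z))) (at s)"
      by (auto intro!: has_derivative_Pair derivative_eq_intros simp: mult.commute)
    moreover have "(L has_derivative L' (?path s t)) (at (?path s t))" using L' t by simp
    ultimately have "((\<lambda>s. L (?path s t)) has_derivative (\<lambda>h. L' (?path s t) (h *\<^sub>R (0, (t - q) *\<^sub>R z, z)))) (at s)"
      by (rule has_derivative_compose)
    then have "((\<lambda>s. L (?path s t)) has_real_derivative ?fx s t) (at s)"
      unfolding has_field_derivative_def blinfun.scaleR_right real_scaleR_def mult_commute_abs .
    from DERIV_diff[OF this DERIV_const[of "L (t, xb t, w t)"]]
    show "((\<lambda>s. ?f s t) has_field_derivative ?fx s t) (at s within UNIV)" by simp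
  next
    fix s show "?f s integrable_on cbox c' d'"
      using integrable_segment[OF sub cw, of q "s *\<^sub>R z"] unfolding cd .
  next
    have "continuous_on (UNIV \<times> closed_segment c d) (\<lambda>y. L' (?path (fst y) (snd y)) (0, (snd y - q) *\<^sub>R z, z))"
      using ab by (intro continuous_intros blinfun.continuous_on continuous_on_compose2[OF cont_L']
          continuous_on_compose2[OF cw] continuous_on_compose2[OF x]) auto
    then show "continuous_on (UNIV \<times> cbox c' d') (\<lambda>(s, t). ?fx s t)"
      unfolding cd by (simp add: split_beta)
  qed auto
  then show ?thesis unfolding cd by simp
qed

text \<open>With the support fixed, the increment as a function of the amplitude is zero at
  \<open>0\<close> and non-negative for small positive amplitudes, so its derivative at
  \<open>0\<close> cannot be negative. The amplitude thus tends to zero before the support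
  shrinks.\<close>

lemma first_variation_nonneg:
  assumes lam: "0 < lam" "lam < 1" and z': "z' = (lam / (lam - 1)) *\<^sub>R z"
  shows "\<forall>\<^sub>F e in at_right 0.
      (\<lambda>t. L' (t, xb t, w t) (0, (t - \<theta>) *\<^sub>R z, z))
        integrable_on closed_segment \<theta> (\<theta> + \<sigma> * (lam * e)) \<and>
      (\<lambda>t. L' (t, xb t, w t) (0, (t - (\<theta> + \<sigma> * e)) *\<^sub>R z', z'))
        integrable_on closed_segment (\<theta> + \<sigma> * (lam * e)) (\<theta> + \<sigma> * e) \<and>
      0 \<le> integral (closed_segment \<theta> (\<theta> + \<sigma> * (lam * e)))
            (\<lambda>t. L' (t, xb t, w t) (0, (t - \<theta>) *\<^sub>R z, z))
        + integral (closed_segment (\<theta> + \<sigma> * (lam * e)) (\<theta> + \<sigma> * e))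
            (\<lambda>t. L' (t, xb t, w t) (0, (t - (\<theta> + \<sigma> * e)) *\<^sub>R z', z'))"
proof -
  obtain \<delta> where \<delta>: "\<delta> > 0"
    "\<And>e z z'. 0 < e \<Longrightarrow> closed_segment \<theta> (\<theta> + \<sigma> * e) \<subseteq> {t0..t1} \<Longrightarrow> e * norm z \<le> \<delta> \<Longrightarrow>
      z' = (lam / (lam - 1)) *\<^sub>R z \<Longrightarrow>
      0 \<le> integral (closed_segment \<theta> (\<theta> + \<sigma> * (lam * e)))
            (\<lambda>t. L (t, xb t + (t - \<theta>) *\<^sub>R z, w t + z) - L (t, xb t, w t))
        + integral (closed_segment (\<theta> + \<sigma> * (lam * e)) (\<theta> + \<sigma> * e))
            (\<lambda>t. L (t, xb t + (t - (\<theta> + \<sigma> * e)) *\<^sub>R z', w t + z') - L (t, xb t, w t))"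
    using one_sided_tent_nonneg[OF lam] by blast
  show ?thesis
    using eventually_segment
  proof eventually_elim
    case (elim e)
    then have e: "0 < e" by blast
    let ?q = "\<theta> + \<sigma> * e"
    let ?s1 = "closed_segment \<theta> (\<theta> + \<sigma> * (lam * e))"
    let ?s2 = "closed_segment (\<theta> + \<sigma> * (lam * e)) ?q"
    note s = sub_segment[OF lam e]
    have sub: "?s1 \<subseteq> {t0..t1}" "?s2 \<subseteq> {t0..t1}" using s elim by auto
    have cw: "continuous_on ?s1 w" "continuous_on ?s2 w" using s elim continuous_on_subset by blast+
    have int: "(\<lambda>t. L' (t, xb t, w t) (0, (t - q) *\<^sub>R y, y)) integrable_on closed_segment c d"
      if sub: "closed_segment c d \<subseteq> {t0..t1}" and cw: "continuous_on (closed_segment c d) w" for c d q y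
    proof (rule integrable_continuous_segment)
      have x: "continuous_on (closed_segment c d) xb"
        using KC1_E[OF xb_KC1] continuous_on_subset[OF _ sub] by metis
      show "continuous_on (closed_segment c d) (\<lambda>t. L' (t, xb t, w t) (0, (t - q) *\<^sub>R y, y))"
        using sub I by (intro continuous_intros blinfun.continuous_on continuous_on_compose2[OF cont_L'] cw x) auto
    qed
    let ?G = "\<lambda>s. integral ?s1 (\<lambda>t. L (t, xb t + (t - \<theta>) *\<^sub>R (s *\<^sub>R z), w t + s *\<^sub>R z) - L (t, xb t, w t))
        + integral ?s2 (\<lambda>t. L (t, xb t + (t - ?q) *\<^sub>R (s *\<^sub>R z'), w t + s *\<^sub>R z') - L (t, xb t, w t))"
    let ?l = "integral ?s1 (\<lambda>t. L' (t, xb t, w t) (0, (t - \<theta>) *\<^sub>R z, z))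
        + integral ?s2 (\<lambda>t. L' (t, xb t, w t) (0, (t - ?q) *\<^sub>R z', z'))"
    have G': "(?G has_real_derivative ?l) (at 0)"
      by (intro DERIV_add segment_first_variation sub cw)
    have "0 \<le> ?l"
    proof (rule ccontr)
      assume "\<not> 0 \<le> ?l"
      with DERIV_neg_dec_right[OF G'] obtain r where r: "r > 0" "\<And>h. 0 < h \<Longrightarrow> h < r \<Longrightarrow> ?G (0 + h) < ?G 0"
        by (auto simp: not_le)
      \<comment> \<open>An amplitude in the range where the increment would be negative, yet small
        enough for the scaled tent to be an admissible competitor; the summand \<open>1\<close>
        keeps the denominator positive when \<open>z = 0\<close>.\<close>
      define k where "k = min (r / 2) (\<delta> / (e * norm z + 1))"
      have pos: "0 < e * norm z + 1" using e by (simp add: add_nonneg_pos)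
      have k: "0 < k" "k < r" using r(1) \<delta>(1) pos unfolding k_def by auto
      have "k * (e * norm z + 1) \<le> \<delta>"
        using pos unfolding k_def by (simp add: pos_le_divide_eq[symmetric])
      then have "e * norm (k *\<^sub>R z) \<le> \<delta>" using k by (simp add: algebra_simps)
      then have "0 \<le> ?G k"
        using elim z' by (intro \<delta>(2)[OF e]) auto
      moreover have "?G 0 = 0" by simp
      ultimately show False using r(2)[of k] k by simp
    qed
    then show ?case using int[OF sub(1) cw(1)] int[OF sub(2) cw(2)] by blast
  qed
qed

lemma L'_split:
  assumes "t \<in> {a<..<b}"
  shows "L' (t, x, v) (0, r *\<^sub>R z, z) = r * (L_x L (t, x, v) \<bullet> z) + L_v L (t, x, v) \<bullet> z"
proof -
  have "(0, r *\<^sub>R z, z) = r *\<^sub>R (0, z, 0) + (0, 0, z)" by simp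
  from arg_cong[OF this, of "L' (t, x, v)"] have "L' (t, x, v) (0, r *\<^sub>R z, z) = r * L' (t, x, v) (0, z, 0) + L' (t, x, v) (0, 0, z)"
    by (simp only: blinfun.add_right blinfun.scaleR_right real_scaleR_def)
  then show ?thesis using inner_L_x[OF assms] inner_L_v[OF assms] by simp
qed

text \<open>The second-order scheme is applied to the integrand of the first variation. Its constant
  terms are linear in the slope and so cancel by the closing condition; \<open>B\<close> comes from
  expanding \<open>L_v\<close> in time.\<close>

lemma Euler_ineq:
  assumes B: "((\<lambda>t. L_v L (t, xb t, w t)) has_vector_derivative B) (at \<theta> within T)"
    and lam: "0 < lam" "lam < 1" and z': "z' = (lam / (lam - 1)) *\<^sub>R z"
  shows "0 \<le> \<sigma> * (lam\<^sup>2 * (B \<bullet> z + L_x L (\<theta>, xb \<theta>, w \<theta>) \<bullet> z) + (1 - lam\<^sup>2) * (B \<bullet> z')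
    - (1 - lam)\<^sup>2 * (L_x L (\<theta>, xb \<theta>, w \<theta>) \<bullet> z'))"
proof (rule tent_second_order[OF \<sigma> lam])
  let ?p = "(\<theta>, xb \<theta>, w \<theta>)"
  show "lam * (L_v L ?p \<bullet> z) + (1 - lam) * (L_v L ?p \<bullet> z') = 0"
  proof -
    have "lam + (1 - lam) * (lam / (lam - 1)) = 0" using lam by (simp add: field_simps)
    then have "(lam + (1 - lam) * (lam / (lam - 1))) * (L_v L ?p \<bullet> z) = 0" by simp
    then show ?thesis unfolding z' inner_scaleR_right by (simp only: distrib_right mult.assoc)
  qed
  fix \<rho> :: real assume \<rho>: "\<rho> > 0"
  \<comment> \<open>\<open>L_x\<close> is multiplied by a displacement factor of size at most
    \<open>e\<close>, so its continuity at \<theta> already yields an error of order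
    \<open>\<rho> * e\<close>.\<close>
  have nearx: "\<forall>\<^sub>F e in at_right 0. \<forall>t. 0 \<le> \<sigma> * (t - \<theta>) \<longrightarrow> \<bar>t - \<theta>\<bar> \<le> e \<longrightarrow>
      t \<in> {a<..<b} \<longrightarrow> \<bar>L_x L (t, xb t, w t) \<bullet> y - L_x L ?p \<bullet> y\<bar> \<le> \<rho> / 2" for y
  proof (rule eventually_one_sided)
    have path: "((\<lambda>t. (t, xb t, w t)) \<longlongrightarrow> ?p) (at \<theta> within T)"
      using has_derivative_continuous[OF has_derivative_path[of 0]] by (simp add: continuous_within)
    have "isCont L' ?p"
      using cont_L' \<theta>_ab by (intro continuous_on_interior[of "{a<..<b} \<times> UNIV \<times> UNIV"]) (auto simp: interior_Times interior_open)
    from isCont_tendsto_compose[OF this path]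
    have "((\<lambda>t. L' (t, xb t, w t) (0, y, 0)) \<longlongrightarrow> L' ?p (0, y, 0)) (at \<theta> within T)"
      by (intro tendsto_intros)
    then have "\<forall>\<^sub>F t in at \<theta> within T. dist (L' (t, xb t, w t) (0, y, 0)) (L' ?p (0, y, 0)) < \<rho> / 2"
      using \<rho> by (intro tendstoD) auto
    then show "\<forall>\<^sub>F t in at \<theta> within T. t \<in> {a<..<b} \<longrightarrow> \<bar>L_x L (t, xb t, w t) \<bullet> y - L_x L ?p \<bullet> y\<bar> \<le> \<rho> / 2"
    proof eventually_elim
      case (elim t)
      then show ?case using inner_L_x \<theta>_ab by (auto simp: dist_real_def)
    qed
  qed (use \<rho> in simp)
  have nearv: "\<forall>\<^sub>F e in at_right 0. \<forall>t. 0 \<le> \<sigma> * (t - \<theta>) \<longrightarrow> \<bar>t - \<theta>\<bar> \<le> e \<longrightarrow>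
      \<bar>L_v L (t, xb t, w t) \<bullet> y - L_v L ?p \<bullet> y - B \<bullet> y * (t - \<theta>)\<bar> \<le> \<rho> / 2 * \<bar>t - \<theta>\<bar>" for y
  proof (rule eventually_one_sided)
    have "((\<lambda>t. L_v L (t, xb t, w t) \<bullet> y) has_derivative (\<lambda>h. (h *\<^sub>R B) \<bullet> y)) (at \<theta> within T)"
      using B unfolding has_vector_derivative_def by (rule has_derivative_inner_left)
    then have "\<forall>\<^sub>F t in at \<theta> within T. norm (L_v L (t, xb t, w t) \<bullet> y - L_v L ?p \<bullet> y - ((t - \<theta>) *\<^sub>R B) \<bullet> y) \<le> \<rho> / 2 * norm (t - \<theta>)"
      using half_gt_zero[OF \<rho>] unfolding has_derivative_within_alt2 by blast
    then show "\<forall>\<^sub>F t in at \<theta> within T. \<bar>L_v L (t, xb t, w t) \<bullet> y - L_v L ?p \<bullet> y - B \<bullet> y * (t - \<theta>)\<bar> \<le> \<rho> / 2 * \<bar>t - \<theta>\<bar>"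
      by (simp add: mult.commute)
  qed simp
  show "\<forall>\<^sub>F e in at_right 0.
      (\<lambda>t. L' (t, xb t, w t) (0, (t - \<theta>) *\<^sub>R z, z)) integrable_on closed_segment \<theta> (\<theta> + \<sigma> * (lam * e)) \<and>
      (\<lambda>t. L' (t, xb t, w t) (0, (t - (\<theta> + \<sigma> * e)) *\<^sub>R z', z'))
        integrable_on closed_segment (\<theta> + \<sigma> * (lam * e)) (\<theta> + \<sigma> * e) \<and>
      (\<forall>t \<in> closed_segment \<theta> (\<theta> + \<sigma> * (lam * e)).
        \<bar>L' (t, xb t, w t) (0, (t - \<theta>) *\<^sub>R z, z) - (L_v L ?p \<bullet> z + (B \<bullet> z + L_x L ?p \<bullet> z) * (t - \<theta>))\<bar> \<le> \<rho> * e) \<and>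
      (\<forall>t \<in> closed_segment (\<theta> + \<sigma> * (lam * e)) (\<theta> + \<sigma> * e).
        \<bar>L' (t, xb t, w t) (0, (t - (\<theta> + \<sigma> * e)) *\<^sub>R z', z')
          - (L_v L ?p \<bullet> z' + B \<bullet> z' * (t - \<theta>) + L_x L ?p \<bullet> z' * (t - (\<theta> + \<sigma> * e)))\<bar> \<le> \<rho> * e) \<and>
      0 \<le> integral (closed_segment \<theta> (\<theta> + \<sigma> * (lam * e))) (\<lambda>t. L' (t, xb t, w t) (0, (t - \<theta>) *\<^sub>R z, z))
        + integral (closed_segment (\<theta> + \<sigma> * (lam * e)) (\<theta> + \<sigma> * e))
            (\<lambda>t. L' (t, xb t, w t) (0, (t - (\<theta> + \<sigma> * e)) *\<^sub>R z', z'))"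
    using eventually_segment first_variation_nonneg[OF lam z'] nearx[of z] nearx[of z'] nearv[of z] nearv[of z']
  proof eventually_elim
    case (elim e)
    then have e: "0 < e" and sub: "closed_segment \<theta> (\<theta> + \<sigma> * e) \<subseteq> {t0..t1}" by blast+
    note s = sub_segment[OF lam e]
    have key: "\<bar>L' (t, xb t, w t) (0, (t - q) *\<^sub>R y, y) - (L_v L ?p \<bullet> y + B \<bullet> y * (t - \<theta>) + L_x L ?p \<bullet> y * (t - q))\<bar> \<le> \<rho> * e"
      if t: "t \<in> closed_segment \<theta> (\<theta> + \<sigma> * e)" and q: "\<bar>t - q\<bar> \<le> e"
        and x: "\<bar>L_x L (t, xb t, w t) \<bullet> y - L_x L ?p \<bullet> y\<bar> \<le> \<rho> / 2"
        and v: "\<bar>L_v L (t, xb t, w t) \<bullet> y - L_v L ?p \<bullet> y - B \<bullet> y * (t - \<theta>)\<bar> \<le> \<rho> / 2 * \<bar>t - \<theta>\<bar>" for t q y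
    proof -
      have tab: "t \<in> {a<..<b}" using t sub I by auto
      have "\<bar>(t - q) * (L_x L (t, xb t, w t) \<bullet> y - L_x L ?p \<bullet> y)\<bar> \<le> e * (\<rho> / 2)"
        unfolding abs_mult using q x by (intro mult_mono) auto
      moreover have "\<rho> / 2 * \<bar>t - \<theta>\<bar> \<le> \<rho> / 2 * e"
        using segment_bounds(3)[OF t e] \<rho> by (intro mult_left_mono) auto
      ultimately have "\<bar>(t - q) * (L_x L (t, xb t, w t) \<bullet> y - L_x L ?p \<bullet> y)
          + (L_v L (t, xb t, w t) \<bullet> y - L_v L ?p \<bullet> y - B \<bullet> y * (t - \<theta>))\<bar> \<le> e * (\<rho> / 2) + \<rho> / 2 * e"
        by (intro order_trans[OF abs_triangle_ineq add_mono] order_trans[OF v])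
      moreover have "L' (t, xb t, w t) (0, (t - q) *\<^sub>R y, y) - (L_v L ?p \<bullet> y + B \<bullet> y * (t - \<theta>) + L_x L ?p \<bullet> y * (t - q))
        = (t - q) * (L_x L (t, xb t, w t) \<bullet> y - L_x L ?p \<bullet> y)
          + (L_v L (t, xb t, w t) \<bullet> y - L_v L ?p \<bullet> y - B \<bullet> y * (t - \<theta>))"
        unfolding L'_split[OF tab] by (simp add: algebra_simps)
      moreover have "e * (\<rho> / 2) + \<rho> / 2 * e = \<rho> * e" by simp
      ultimately show ?thesis by (simp only:)
    qed
    have tab: "t \<in> {a<..<b}" if "t \<in> closed_segment \<theta> (\<theta> + \<sigma> * e)" for t using that sub I by auto
    show ?case
    proof (intro conjI ballI)
      fix t assume "t \<in> closed_segment \<theta> (\<theta> + \<sigma> * (lam * e))"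
      with s have t: "t \<in> closed_segment \<theta> (\<theta> + \<sigma> * e)" by blast
      have "\<bar>L' (t, xb t, w t) (0, (t - \<theta>) *\<^sub>R z, z) - (L_v L ?p \<bullet> z + B \<bullet> z * (t - \<theta>) + L_x L ?p \<bullet> z * (t - \<theta>))\<bar> \<le> \<rho> * e"
        using elim segment_bounds[OF t e] tab[OF t] by (intro key[OF t]) blast+
      then show "\<bar>L' (t, xb t, w t) (0, (t - \<theta>) *\<^sub>R z, z) - (L_v L ?p \<bullet> z + (B \<bullet> z + L_x L ?p \<bullet> z) * (t - \<theta>))\<bar> \<le> \<rho> * e"
        by (simp only: distrib_right add.assoc)
    next
      fix t assume "t \<in> closed_segment (\<theta> + \<sigma> * (lam * e)) (\<theta> + \<sigma> * e)"
      with s have t: "t \<in> closed_segment \<theta> (\<theta> + \<sigma> * e)" by blast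
      show "\<bar>L' (t, xb t, w t) (0, (t - (\<theta> + \<sigma> * e)) *\<^sub>R z', z')
          - (L_v L ?p \<bullet> z' + B \<bullet> z' * (t - \<theta>) + L_x L ?p \<bullet> z' * (t - (\<theta> + \<sigma> * e)))\<bar> \<le> \<rho> * e"
        using elim segment_bounds[OF t e] tab[OF t] by (intro key[OF t]) blast+
    qed (use elim in auto)
  qed
qed

lemma Euler:
  assumes B: "((\<lambda>t. L_v L (t, xb t, w t)) has_vector_derivative B) (at \<theta> within T)"
  shows "B \<bullet> z = L_x L (\<theta>, xb \<theta>, w \<theta>) \<bullet> z"
proof -
  \<comment> \<open>For \<open>lam = 1/2\<close> the slopes are \<open>y\<close> and
    \<open>- y\<close>, and the expression collapses to half of the difference shown. The two signs
    of \<open>z\<close> then turn the inequality into an equation.\<close>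
  have "0 \<le> \<sigma> * (L_x L (\<theta>, xb \<theta>, w \<theta>) \<bullet> y - B \<bullet> y)" for y
    using Euler_ineq[OF B, of "1/2" "- y" y] by (simp add: field_simps power2_eq_square)
  from this[of z] this[of "- z"] show ?thesis using \<sigma> by auto
qed

end

section \<open>The second-order conditions\<close>

context smooth_one_sided
begin

text \<open>Existence of the derivative of \<open>Q2\<close> belongs to the conclusion: it is
  assembled from the expansions that also describe the increment, so both sides involve the same
  coefficients \<open>D c\<close>.\<close>

lemma second_order_condition:
  assumes lam: "0 < lam" "lam < 1" and z': "z' = (lam / (lam - 1)) *\<^sub>R z"
    and E0: "E L xb w \<theta> z = 0" "E L xb w \<theta> z' = 0"
  shows "\<exists>D. ((\<lambda>t. Q2 L xb w t lam z) has_real_derivative D) (at \<theta> within T) \<and>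
    0 \<le> \<sigma> * (lam * M1 L xb w \<theta> lam z + D)"
proof -
  define k where "k = lam / (lam - 1)"
  have k: "(1 - lam) * k = - lam" using lam by (simp add: k_def field_simps)
  let ?p = "(\<theta>, xb \<theta>, w \<theta>)"
  let ?F = "\<lambda>c t y. L (t, xb t + y, w t + c)"
  let ?x = "\<lambda>c. L_x L (\<theta>, xb \<theta>, w \<theta> + c)"
  let ?exp = "\<lambda>c D. \<forall>K \<rho>. 0 \<le> K \<longrightarrow> 0 < \<rho> \<longrightarrow> (\<forall>\<^sub>F e in at_right 0. \<forall>t y. 0 \<le> \<sigma> * (t - \<theta>) \<longrightarrow> \<bar>t - \<theta>\<bar> \<le> e \<longrightarrow> norm y \<le> e * K \<longrightarrow>
      \<bar>?F c t y - (L (\<theta>, xb \<theta>, w \<theta> + c) + D * (t - \<theta>) + ?x c \<bullet> y)\<bar> \<le> \<rho> * e)"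
  have "\<exists>D. ((\<lambda>t. L (t, xb t, w t + c)) has_real_derivative D) (at \<theta> within T) \<and> ?exp c D" for c
    by (rule L_expansion[of c]) blast
  then have "\<forall>c. \<exists>D. ((\<lambda>t. L (t, xb t, w t + c)) has_real_derivative D) (at \<theta> within T) \<and> ?exp c D" ..
  \<comment> \<open>\<open>D c\<close> is the derivative of \<open>L\<close> along the curve with
    its velocity shifted by \<open>c\<close>; \<open>D 0\<close> belongs to the unperturbed
    curve.\<close>
  from choice[OF this] obtain D where
    Dex: "\<And>c. ((\<lambda>t. L (t, xb t, w t + c)) has_real_derivative D c) (at \<theta> within T) \<and> ?exp c (D c)"
    by blast
  note D = Dex[THEN conjunct1] and ex = Dex[THEN conjunct2, rule_format]
  obtain Lv' where "(L_v L has_derivative Lv') (at ?p)"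
    using diff_L_v[of ?p] \<theta>_ab unfolding differentiable_def by auto
  then have "((\<lambda>t. L_v L (t, xb t, w t)) has_derivative (\<lambda>h. Lv' (h *\<^sub>R (1, w \<theta>, A)))) (at \<theta> within T)"
    using has_derivative_compose[OF has_derivative_path[of 0], of "L_v L" Lv'] by simp
  moreover have "Lv' (h *\<^sub>R (1, w \<theta>, A)) = h *\<^sub>R Lv' (1, w \<theta>, A)" for h
    using \<open>(L_v L has_derivative Lv') (at ?p)\<close> has_derivative_linear linear_scale by blast
  ultimately have "((\<lambda>t. L_v L (t, xb t, w t)) has_vector_derivative Lv' (1, w \<theta>, A)) (at \<theta> within T)"
    unfolding has_vector_derivative_def by (simp only:)
  then obtain B where B: "((\<lambda>t. L_v L (t, xb t, w t)) has_vector_derivative B) (at \<theta> within T)" by blast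
  note Euler = Euler[OF B, of z]
  have E': "((\<lambda>t. E L xb w t c) has_real_derivative (D c - D 0 - B \<bullet> c)) (at \<theta> within T)" for c
  proof -
    have "((\<lambda>t. L_v L (t, xb t, w t) \<bullet> c) has_derivative (\<lambda>h. (h *\<^sub>R B) \<bullet> c)) (at \<theta> within T)"
      using B unfolding has_vector_derivative_def by (rule has_derivative_inner_left)
    then have "((\<lambda>t. L_v L (t, xb t, w t) \<bullet> c) has_real_derivative (B \<bullet> c)) (at \<theta> within T)"
      unfolding has_field_derivative_def by (simp add: mult_commute_abs)
    with D[of c] D[of 0] show ?thesis
      unfolding E_def by (intro DERIV_diff) simp_all
  qed
  let ?Q = "lam\<^sup>2 * (D z - D 0 - B \<bullet> z) + (1 - lam\<^sup>2) * (D z' - D 0 - B \<bullet> z')"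
  have Q: "((\<lambda>t. Q2 L xb w t lam z) has_real_derivative ?Q) (at \<theta> within T)"
    unfolding Q2_def z'[symmetric] by (intro DERIV_add DERIV_cmult E')
  have "0 \<le> \<sigma> * (lam\<^sup>2 * (D z - D 0 + ?x z \<bullet> z) + (1 - lam\<^sup>2) * (D z' - D 0) - (1 - lam)\<^sup>2 * (?x z' \<bullet> z'))"
  proof (rule tent_second_order[OF \<sigma> lam])
    show "lam * (L (\<theta>, xb \<theta>, w \<theta> + z) - L ?p) + (1 - lam) * (L (\<theta>, xb \<theta>, w \<theta> + z') - L ?p) = 0"
    proof -
      \<comment> \<open>A vanishing excess makes each increment of \<open>L\<close> linear in the
        slope, and linear terms cancel by the closing condition.\<close>
      have "L (\<theta>, xb \<theta>, w \<theta> + z) - L ?p = L_v L ?p \<bullet> z" "L (\<theta>, xb \<theta>, w \<theta> + z') - L ?p = k * (L_v L ?p \<bullet> z)"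
        using E0 by (simp_all add: E_def z' k_def)
      moreover have "lam * X + (1 - lam) * (k * X) = (lam + (1 - lam) * k) * X" for X
        by (simp only: distrib_right mult.assoc)
      ultimately show ?thesis unfolding k by simp
    qed
    fix \<rho> :: real assume "\<rho> > 0"
    then have \<rho>: "\<rho> / 2 > 0" by simp
    show "\<forall>\<^sub>F e in at_right 0.
      (\<lambda>t. ?F z t ((t - \<theta>) *\<^sub>R z) - L (t, xb t, w t)) integrable_on closed_segment \<theta> (\<theta> + \<sigma> * (lam * e)) \<and>
      (\<lambda>t. ?F z' t ((t - (\<theta> + \<sigma> * e)) *\<^sub>R z') - L (t, xb t, w t))
        integrable_on closed_segment (\<theta> + \<sigma> * (lam * e)) (\<theta> + \<sigma> * e) \<and>
      (\<forall>t \<in> closed_segment \<theta> (\<theta> + \<sigma> * (lam * e)).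
        \<bar>?F z t ((t - \<theta>) *\<^sub>R z) - L (t, xb t, w t)
          - (L (\<theta>, xb \<theta>, w \<theta> + z) - L ?p + (D z - D 0 + ?x z \<bullet> z) * (t - \<theta>))\<bar> \<le> \<rho> * e) \<and>
      (\<forall>t \<in> closed_segment (\<theta> + \<sigma> * (lam * e)) (\<theta> + \<sigma> * e).
        \<bar>?F z' t ((t - (\<theta> + \<sigma> * e)) *\<^sub>R z') - L (t, xb t, w t)
          - (L (\<theta>, xb \<theta>, w \<theta> + z') - L ?p + (D z' - D 0) * (t - \<theta>) + (?x z' \<bullet> z') * (t - (\<theta> + \<sigma> * e)))\<bar> \<le> \<rho> * e) \<and>
      0 \<le> integral (closed_segment \<theta> (\<theta> + \<sigma> * (lam * e))) (\<lambda>t. ?F z t ((t - \<theta>) *\<^sub>R z) - L (t, xb t, w t))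
        + integral (closed_segment (\<theta> + \<sigma> * (lam * e)) (\<theta> + \<sigma> * e))
            (\<lambda>t. ?F z' t ((t - (\<theta> + \<sigma> * e)) *\<^sub>R z') - L (t, xb t, w t))"
      using eventually_segment eventually_tent_nonneg[OF lam z']
        ex[OF norm_ge_zero[of z] \<rho>, of z] ex[OF norm_ge_zero[of z'] \<rho>, of z'] ex[OF order_refl \<rho>, of 0]
    proof eventually_elim
      case (elim e)
      then have e: "0 < e" by blast
      note s = sub_segment[OF lam e]
      \<comment> \<open>The perturbed and the unperturbed integrand are expanded with error
        \<open>\<rho> / 2 * e\<close> each, and the errors add.\<close>
      have key: "\<bar>?F c t ((t - q) *\<^sub>R c) - L (t, xb t, w t)
          - (L (\<theta>, xb \<theta>, w \<theta> + c) - L ?p + (D c - D 0) * (t - \<theta>) + (?x c \<bullet> c) * (t - q))\<bar> \<le> \<rho> * e"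
        if t: "t \<in> closed_segment \<theta> (\<theta> + \<sigma> * e)" and q: "\<bar>t - q\<bar> \<le> e"
          and c: "\<forall>t y. 0 \<le> \<sigma> * (t - \<theta>) \<longrightarrow> \<bar>t - \<theta>\<bar> \<le> e \<longrightarrow> norm y \<le> e * norm c \<longrightarrow>
            \<bar>?F c t y - (L (\<theta>, xb \<theta>, w \<theta> + c) + D c * (t - \<theta>) + ?x c \<bullet> y)\<bar> \<le> \<rho> / 2 * e" for t q c
      proof -
        note tb = segment_bounds[OF t e]
        have "norm ((t - q) *\<^sub>R c) \<le> e * norm c" using q by (auto intro: mult_right_mono)
        then have 1: "\<bar>?F c t ((t - q) *\<^sub>R c) - (L (\<theta>, xb \<theta>, w \<theta> + c) + D c * (t - \<theta>) + ?x c \<bullet> ((t - q) *\<^sub>R c))\<bar> \<le> \<rho> / 2 * e"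
          using c tb by blast
        have 0: "\<bar>?F 0 t 0 - (L (\<theta>, xb \<theta>, w \<theta> + 0) + D 0 * (t - \<theta>) + ?x 0 \<bullet> 0)\<bar> \<le> \<rho> / 2 * e"
          using elim(5)[rule_format, OF tb(1,3), of 0] by simp
        have "\<bar>X - Y - (a - a0 + (d - d0) * r + g * s)\<bar> \<le> \<rho> * e"
          if "\<bar>X - (a + d * r + s * g)\<bar> \<le> \<rho> / 2 * e" "\<bar>Y - (a0 + d0 * r)\<bar> \<le> \<rho> / 2 * e" for X Y a a0 d d0 r g s :: real
        proof -
          have "X - Y - (a - a0 + (d - d0) * r + g * s) = (X - (a + d * r + s * g)) - (Y - (a0 + d0 * r))"
            by (simp add: algebra_simps)
          also have "\<bar>\<dots>\<bar> \<le> \<rho> / 2 * e + \<rho> / 2 * e"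
            using that by (intro order_trans[OF abs_triangle_ineq4 add_mono])
          finally show ?thesis by simp
        qed
        from this[OF 1[unfolded inner_scaleR_right] 0[unfolded inner_zero_right add_0_right]]
        show ?thesis .
      qed
      show ?case
      proof (intro conjI ballI)
        fix t assume "t \<in> closed_segment \<theta> (\<theta> + \<sigma> * (lam * e))"
        with s have t: "t \<in> closed_segment \<theta> (\<theta> + \<sigma> * e)" by blast
        have "\<bar>?F z t ((t - \<theta>) *\<^sub>R z) - L (t, xb t, w t)
          - (L (\<theta>, xb \<theta>, w \<theta> + z) - L ?p + (D z - D 0) * (t - \<theta>) + (?x z \<bullet> z) * (t - \<theta>))\<bar> \<le> \<rho> * e"
          by (rule key[OF t segment_bounds(3)[OF t e] elim(3)])
        then show "\<bar>?F z t ((t - \<theta>) *\<^sub>R z) - L (t, xb t, w t)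
          - (L (\<theta>, xb \<theta>, w \<theta> + z) - L ?p + (D z - D 0 + ?x z \<bullet> z) * (t - \<theta>))\<bar> \<le> \<rho> * e"
          by (simp only: distrib_right add.assoc)
      next
        fix t assume "t \<in> closed_segment (\<theta> + \<sigma> * (lam * e)) (\<theta> + \<sigma> * e)"
        with s have t: "t \<in> closed_segment \<theta> (\<theta> + \<sigma> * e)" by blast
        show "\<bar>?F z' t ((t - (\<theta> + \<sigma> * e)) *\<^sub>R z') - L (t, xb t, w t)
          - (L (\<theta>, xb \<theta>, w \<theta> + z') - L ?p + (D z' - D 0) * (t - \<theta>) + (?x z' \<bullet> z') * (t - (\<theta> + \<sigma> * e)))\<bar> \<le> \<rho> * e"
          by (rule key[OF t segment_bounds(4)[OF t e] elim(4)])
      qed (use elim(2) in auto)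
    qed
  qed
  also have "lam\<^sup>2 * (D z - D 0 + ?x z \<bullet> z) + (1 - lam\<^sup>2) * (D z' - D 0) - (1 - lam)\<^sup>2 * (?x z' \<bullet> z')
      = lam * M1 L xb w \<theta> lam z + ?Q"
  proof -
    have zk: "z' = k *\<^sub>R z" unfolding z' k_def ..
    \<comment> \<open>The Euler equation replaces the unperturbed \<open>L_x\<close> by
      \<open>B\<close>, the only place where it enters.\<close>
    have M: "M1 L xb w \<theta> lam z = lam * (?x z \<bullet> z - B \<bullet> z) + (1 - lam) * (?x z' \<bullet> z - B \<bullet> z)"
      unfolding M1_def \<Delta>L_x_def z'[symmetric] inner_diff_left Euler ..
    \<comment> \<open>With \<open>(1 - lam) * k = - lam\<close> the coefficients of \<open>G\<close>
      on the right, \<open>- lam\<close> from \<open>M1\<close> and \<open>lam\<close> from the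
      derivative of \<open>Q2\<close>, cancel.\<close>
    have "lam\<^sup>2 * (d + X) + (1 - lam\<^sup>2) * d' - (1 - lam)\<^sup>2 * (k * Y)
      = lam * (lam * (X - G) + (1 - lam) * (Y - G)) + (lam\<^sup>2 * (d - G) + (1 - lam\<^sup>2) * (d' - k * G))" for d d' X Y G
    proof -
      have "(1 - lam)\<^sup>2 * (k * Y) = (1 - lam) * ((1 - lam) * k) * Y"
        "(1 - lam\<^sup>2) * (k * G) = (1 + lam) * ((1 - lam) * k) * G"
        by (simp_all add: power2_eq_square algebra_simps)
      then show ?thesis unfolding k right_diff_distrib[of "1 - lam\<^sup>2" d'] by (simp add: power2_eq_square algebra_simps)
    qed
    from this[of "D z - D 0" "?x z \<bullet> z" "D z' - D 0" "?x z' \<bullet> z" "B \<bullet> z"]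
    show ?thesis unfolding M by (simp add: zk)
  qed
  finally show ?thesis using Q by blast
qed

end

text \<open>The hypothesis speaks of derivatives within the half-neighbourhood, whereas the
  integrand uses \<open>vel\<close>. At \<theta> these may disagree, for instance at an angular
  point; continuity of the former identifies its value there with the one-sided limit of the
  latter.\<close>

lemma one_sided_velocity:
  fixes x :: "real \<Rightarrow> 'a::real_normed_vector"
  assumes t01: "t0 < t1" and \<sigma>: "\<sigma> = 1 \<or> \<sigma> = -1" and \<alpha>: "\<alpha> > 0"
    and S: "S = {t. 0 \<le> \<sigma> * (t - \<theta>) \<and> \<sigma> * (t - \<theta>) < \<alpha>}" "S \<subseteq> {t0..t1}"
    and twice: "twice_differentiable_on x S"
    and F: "F = at \<theta> within {t. 0 \<le> \<sigma> * (t - \<theta>)}" "F \<noteq> bot"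
    and w: "w = (vel t0 t1 x)(\<theta> := Lim F (vel t0 t1 x))"
  obtains A where "(w \<longlongrightarrow> w \<theta>) F" "(x has_vector_derivative w \<theta>) F" "(w has_vector_derivative A) F"
proof -
  let ?u = "\<lambda>t. vector_derivative x (at t within S)"
  have \<theta>S: "\<theta> \<in> S" using S \<alpha> by simp
  have FS: "F = at \<theta> within S"
    unfolding F S(1) by (rule at_within_nhd[where S = "{\<theta> - \<alpha><..<\<theta> + \<alpha>}"]) (use \<alpha> \<sigma> in auto)
  have du: "(x has_vector_derivative ?u t) (at t within S)" if "t \<in> S" for t
    using twice that unfolding twice_differentiable_on_def differentiable_on_def
    by (simp add: vector_derivative_works)
  define A where "A = vector_derivative ?u (at \<theta> within S)"
  have A: "(?u has_vector_derivative A) (at \<theta> within S)"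
    using twice \<theta>S unfolding twice_differentiable_on_def differentiable_on_def A_def
    by (simp add: vector_derivative_works)
  \<comment> \<open>Away from \<theta> the half-neighbourhood is a genuine neighbourhood of
    \<open>t\<close>, so the derivative is two-sided.\<close>
  have u: "vel t0 t1 x t = ?u t" if t: "t \<in> S" "t \<noteq> \<theta>" for t
  proof (rule vel_eqI[OF t01])
    let ?U = "{s. 0 < \<sigma> * (s - \<theta>) \<and> \<sigma> * (s - \<theta>) < \<alpha>}"
    have "?U = (if \<sigma> = 1 then {\<theta><..<\<theta> + \<alpha>} else {\<theta> - \<alpha><..<\<theta>})" using \<sigma> by auto
    then have "open ?U" by simp
    moreover have "t \<in> ?U" using t \<sigma> by (auto simp: S)
    ultimately have "at t within S = at t"
      by (intro at_within_open_subset[of t ?U]) (auto simp: S)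
    then show "(x has_vector_derivative ?u t) (at t within {t0..t1})"
      using has_vector_derivative_at_within du[OF t(1)] by metis
  qed (use t S in auto)
  have "(?u \<longlongrightarrow> ?u \<theta>) F"
    using has_vector_derivative_continuous[OF A] by (simp add: FS continuous_within)
  moreover have "\<forall>\<^sub>F t in F. ?u t = vel t0 t1 x t"
    unfolding FS eventually_at using u by (intro exI[of _ 1]) auto
  ultimately have "(vel t0 t1 x \<longlongrightarrow> ?u \<theta>) F" by (rule Lim_transform_eventually)
  then have "Lim F (vel t0 t1 x) = ?u \<theta>" using F(2) by (intro tendsto_Lim)
  then have wu: "w t = ?u t" if "t \<in> S" for t using u that by (simp add: w)
  have "(w has_vector_derivative A) F"
    unfolding FS by (rule has_vector_derivative_transform[OF \<theta>S wu A])
  moreover from this have "(w \<longlongrightarrow> w \<theta>) F"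
    using has_vector_derivative_continuous by (auto simp: FS continuous_within)
  moreover have "(x has_vector_derivative w \<theta>) F" unfolding FS wu[OF \<theta>S] by (rule du[OF \<theta>S])
  ultimately show thesis using that by blast
qed

lemma at_within_sign_right:
  fixes \<theta> :: real
  shows "at \<theta> within {t. \<theta> \<le> t} = at_right \<theta>" "at \<theta> within {t. 0 \<le> 1 * (t - \<theta>)} = at_right \<theta>"
  using at_within_Ici_at_right[of \<theta>] by (simp_all add: atLeast_def)

lemma at_within_sign_left:
  fixes \<theta> :: real
  shows "at \<theta> within {t. t \<le> \<theta>} = at_left \<theta>" "at \<theta> within {t. 0 \<le> (- 1) * (t - \<theta>)} = at_left \<theta>"
  using at_within_Iic_at_left[of \<theta>] by (simp_all add: atMost_def)

section \<open>The one-sided conditions and the condition at a point of twice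
  differentiability\<close>

context strong_extremal
begin

lemma right_condition:
  assumes \<theta>: "\<theta> \<in> {t0..<t1}" and \<alpha>: "\<alpha> > 0" and sub: "{\<theta>..<\<theta> + \<alpha>} \<subseteq> {t0..t1}"
    and twice: "twice_differentiable_on xb {\<theta>..<\<theta> + \<alpha>}" and lam: "lam \<in> {0<..<1}"
    and E0: "E L xb (vel_right t0 t1 xb \<theta>) \<theta> z = 0"
      "E L xb (vel_right t0 t1 xb \<theta>) \<theta> ((lam / (lam - 1)) *\<^sub>R z) = 0"
  shows "\<exists>D. ((\<lambda>t. Q2 L xb (vel_right t0 t1 xb \<theta>) t lam z) has_real_derivative D) (at_right \<theta>) \<and>
    lam * M1 L xb (vel_right t0 t1 xb \<theta>) \<theta> lam z + D \<ge> 0"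
proof -
  let ?w = "vel_right t0 t1 xb \<theta>"
  obtain A where A: "(?w \<longlongrightarrow> ?w \<theta>) (at_right \<theta>)" "(xb has_vector_derivative ?w \<theta>) (at_right \<theta>)"
    "(?w has_vector_derivative A) (at_right \<theta>)"
    by (rule one_sided_velocity[OF t01 _ \<alpha> _ sub twice, of 1 \<theta> "at_right \<theta>" ?w])
      (auto simp: vel_right_def at_within_sign_right)
  interpret smooth_one_sided L L' a b t0 t1 x0 x1 xb \<theta> 1 ?w A
    by unfold_locales (use \<theta> A in \<open>auto simp: vel_right_def at_within_sign_right\<close>)
  show ?thesis
    using second_order_condition[of lam _ z, OF _ _ refl E0] lam
    unfolding at_within_sign_right by simp
qed

lemma left_condition:
  assumes \<theta>: "\<theta> \<in> {t0<..t1}" and \<alpha>: "\<alpha> > 0" and sub: "{\<theta> - \<alpha><..\<theta>} \<subseteq> {t0..t1}"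
    and twice: "twice_differentiable_on xb {\<theta> - \<alpha><..\<theta>}" and lam: "lam \<in> {0<..<1}"
    and E0: "E L xb (vel_left t0 t1 xb \<theta>) \<theta> z = 0"
      "E L xb (vel_left t0 t1 xb \<theta>) \<theta> ((lam / (lam - 1)) *\<^sub>R z) = 0"
  shows "\<exists>D. ((\<lambda>t. Q2 L xb (vel_left t0 t1 xb \<theta>) t lam z) has_real_derivative D) (at_left \<theta>) \<and>
    lam * M1 L xb (vel_left t0 t1 xb \<theta>) \<theta> lam z + D \<le> 0"
proof -
  let ?w = "vel_left t0 t1 xb \<theta>"
  obtain A where A: "(?w \<longlongrightarrow> ?w \<theta>) (at_left \<theta>)" "(xb has_vector_derivative ?w \<theta>) (at_left \<theta>)"
    "(?w has_vector_derivative A) (at_left \<theta>)"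
    by (rule one_sided_velocity[OF t01 _ \<alpha> _ sub twice, of "- 1" \<theta> "at_left \<theta>" ?w])
      (auto simp: vel_left_def at_within_sign_left)
  interpret smooth_one_sided L L' a b t0 t1 x0 x1 xb \<theta> "- 1" ?w A
    by unfold_locales (use \<theta> A in \<open>auto simp: vel_left_def at_within_sign_left\<close>)
  show ?thesis
    using second_order_condition[of lam _ z, OF _ _ refl E0] lam
    unfolding at_within_sign_left by (auto simp: algebra_simps)
qed

text \<open>The velocity is continuous at \<theta>, so both sides share the same \<open>M1\<close>,
  and their inequalities force \<open>lam * M1 + D = 0\<close> with \<open>D\<close> the derivative
  of \<open>Q2\<close>.\<close>

lemma two_sided_condition:
  assumes \<theta>: "\<theta> \<in> {t0<..<t1}" and twice: "twice_differentiable_at xb \<theta>" and lam: "lam \<in> {0<..<1}"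
    and E0: "E L xb (vel t0 t1 xb) \<theta> z = 0"
      "E L xb (vel t0 t1 xb) \<theta> ((lam / (lam - 1)) *\<^sub>R z) = 0"
  shows "M1 L xb (vel t0 t1 xb) \<theta> lam z = 0"
proof -
  let ?v = "vel t0 t1 xb" and ?u = "\<lambda>t. vector_derivative xb (at t)"
  let ?Q = "\<lambda>t. Q2 L xb ?v t lam z"
  have "\<forall>\<^sub>F t in nhds \<theta>. t \<in> {t0<..<t1}" using \<theta> by (intro eventually_nhds_in_open) auto
  with twice have "\<forall>\<^sub>F t in nhds \<theta>. xb differentiable (at t) \<and> t \<in> {t0<..<t1}"
    unfolding twice_differentiable_at_def by (auto intro: eventually_conj)
  then obtain N where N: "open N" "\<theta> \<in> N" "\<And>t. t \<in> N \<Longrightarrow> xb differentiable (at t)" "N \<subseteq> {t0<..<t1}"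
    unfolding eventually_nhds by blast
  have du: "(xb has_vector_derivative ?u t) (at t)" if "t \<in> N" for t
    using N(3)[OF that] by (simp add: vector_derivative_works)
  have u: "?u t = ?v t" if t: "t \<in> N" for t
    using vector_derivative_at_within_ivl[OF du[OF t]] N(4) t t01 by (auto simp: vel_def)
  have xb': "(xb has_vector_derivative ?v \<theta>) (at \<theta>)" using du[OF N(2)] unfolding u[OF N(2)] .
  obtain A where "(?u has_vector_derivative A) (at \<theta>)"
    using twice unfolding twice_differentiable_at_def by (auto simp: vector_derivative_works)
  then have A: "(?v has_vector_derivative A) (at \<theta>)"
    by (rule has_vector_derivative_transform_within_open[OF _ N(1,2) u])
  have v_cont: "(?v \<longlongrightarrow> ?v \<theta>) (at \<theta>)"
    using has_vector_derivative_continuous[OF A] by (simp add: continuous_within)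
  interpret R: smooth_one_sided L L' a b t0 t1 x0 x1 xb \<theta> 1 ?v A
    by unfold_locales (use \<theta> in \<open>auto intro: tendsto_within_subset[OF v_cont]
      has_vector_derivative_at_within[OF xb'] has_vector_derivative_at_within[OF A]\<close>)
  interpret Lf: smooth_one_sided L L' a b t0 t1 x0 x1 xb \<theta> "- 1" ?v A
    by unfold_locales (use \<theta> in \<open>auto intro: tendsto_within_subset[OF v_cont]
      has_vector_derivative_at_within[OF xb'] has_vector_derivative_at_within[OF A]\<close>)
  obtain D1 where D1: "(?Q has_real_derivative D1) (at_right \<theta>)"
    "0 \<le> lam * M1 L xb ?v \<theta> lam z + D1"
    using R.second_order_condition[of lam _ z, OF _ _ refl E0] lam unfolding at_within_sign_right by auto
  obtain D2 where D2: "(?Q has_real_derivative D2) (at_left \<theta>)"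
    "lam * M1 L xb ?v \<theta> lam z + D2 \<le> 0"
    using Lf.second_order_condition[of lam _ z, OF _ _ refl E0] lam unfolding at_within_sign_left by auto
  \<comment> \<open>A two-sided derivative ties the two one-sided ones together and allows the
    interior-minimum criterion.\<close>
  have Q_diff: "?Q differentiable (at \<theta>)"
  proof -
    have path: "(\<lambda>t. (t, xb t, ?v t + c)) differentiable (at \<theta>)" for c
    proof -
      have "((\<lambda>t. (t, xb t, ?v t + c)) has_derivative (\<lambda>h. (h, h *\<^sub>R ?v \<theta>, h *\<^sub>R A + 0))) (at \<theta>)"
        using xb' A unfolding has_vector_derivative_def
        by (intro has_derivative_Pair has_derivative_ident has_derivative_add has_derivative_const)
      then show ?thesis unfolding differentiable_def by blast
    qed
    have Ld: "(\<lambda>t. L (t, xb t, ?v t + c)) differentiable (at \<theta>)" for c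
      using path[of c] L'[of "(\<theta>, xb \<theta>, ?v \<theta> + c)"] R.\<theta>_ab has_derivative_compose
      unfolding differentiable_def by blast
    have Lvd: "(\<lambda>t. L_v L (t, xb t, ?v t)) differentiable (at \<theta>)"
    proof -
      obtain p' where p': "((\<lambda>t. (t, xb t, ?v t + 0)) has_derivative p') (at \<theta>)"
        using path[of 0] unfolding differentiable_def by blast
      obtain l' where l': "(L_v L has_derivative l') (at (\<theta>, xb \<theta>, ?v \<theta> + 0))"
        using diff_L_v[of "(\<theta>, xb \<theta>, ?v \<theta> + 0)"] R.\<theta>_ab unfolding differentiable_def by auto
      show ?thesis using has_derivative_compose[OF p' l'] unfolding differentiable_def by auto
    qed
    have "(\<lambda>t. E L xb ?v t c) differentiable (at \<theta>)" for c
      unfolding E_def using Ld[of c] Ld[of 0] Lvd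
      by (intro differentiable_diff differentiable_inner differentiable_const) auto
    then show ?thesis
      unfolding Q2_def by (intro differentiable_add differentiable_mult differentiable_const)
  qed
  then obtain D where D: "(?Q has_real_derivative D) (at \<theta>)"
    using real_differentiable_def by blast
  have "D1 = D"
    by (rule vector_derivative_unique_within[of \<theta> "{\<theta><..}" ?Q])
      (use D1(1) has_field_derivative_at_within[OF D] in
        \<open>auto simp: has_real_derivative_iff_has_vector_derivative[symmetric]\<close>)
  moreover have "D2 = D"
    by (rule vector_derivative_unique_within[of \<theta> "{..<\<theta>}" ?Q])
      (use D2(1) has_field_derivative_at_within[OF D] in
        \<open>auto simp: has_real_derivative_iff_has_vector_derivative[symmetric]\<close>)
  moreover have "D = 0"
  proof -
    obtain S where S: "finite S" "continuous_on ({t0..t1} - S) ?v"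
      using KC1_E[OF xb_KC1] by metis
    \<comment> \<open>\<theta> may itself have been listed in \<open>S\<close>; only the other
      points of \<open>S\<close> are to be avoided, so that the Weierstrass condition is available
      at every nearby \<open>t\<close> different from \<theta>.\<close>
    have "open ({t0<..<t1} - (S - {\<theta>}))" using S(1) by (simp add: open_Diff finite_imp_closed)
    then obtain d where d: "d > 0" "ball \<theta> d \<subseteq> {t0<..<t1} - (S - {\<theta>})"
      using \<theta> by (meson Diff_iff insertI1 openE)
    have Q0: "?Q \<theta> = 0" using E0 by (simp add: Q2_def)
    have "?Q \<theta> \<le> ?Q t" if "\<bar>\<theta> - t\<bar> < d" for t
    proof (cases "t = \<theta>")
      case False
      have "t \<in> ball \<theta> d" using that by (simp add: dist_real_def)
      then have t: "t \<in> {t0<..<t1} - S" using d(2) False by auto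
      have "(?v \<longlongrightarrow> ?v t) (at t)" by (rule tendsto_of_continuous_off_finite[OF S(1) t S(2)])
      then interpret W: one_sided L L' a b t0 t1 x0 x1 xb t 1 ?v
        by unfold_locales (use t in \<open>auto intro: tendsto_within_subset\<close>)
      \<comment> \<open>Both weights in \<open>Q2\<close> are then non-negative, so non-negative
        excesses give a non-negative \<open>Q2\<close>.\<close>
      have "lam\<^sup>2 \<le> 1" using lam by (simp add: power_le_one)
      then have "0 \<le> ?Q t" unfolding Q2_def using W.Weierstrass by simp
      then show ?thesis using Q0 by simp
    qed simp
    then show ?thesis using DERIV_local_min[OF D d(1)] by blast
  qed
  ultimately have "lam * M1 L xb ?v \<theta> lam z = 0" using D1(2) D2(2) by simp
  then show ?thesis using lam by simp
qed

end

theorem theorem3p1: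
  fixes L :: "('n::finite) integrand"
    and a b t0 t1 :: real
    and x0 x1 :: "real ^ 'n"
    and xb :: "real \<Rightarrow> real ^ 'n"
  assumes "t0 < t1" and "{t0..t1} \<subseteq> {a<..<b}"
    and "C1_on L ({a<..<b} \<times> UNIV \<times> UNIV)"
    and "C1_on (L_v L) ({a<..<b} \<times> UNIV \<times> UNIV)"
    and "strong_local_min L t0 t1 x0 x1 xb"
  shows
    "(\<forall>\<theta> \<alpha> \<eta> lam.
        \<theta> \<in> {t0..<t1} \<longrightarrow> \<alpha> > 0 \<longrightarrow> {\<theta>..<\<theta> + \<alpha>} \<subseteq> {t0..t1} \<longrightarrow>
        twice_differentiable_on xb {\<theta>..<\<theta> + \<alpha>} \<longrightarrow>
        \<eta> \<noteq> 0 \<longrightarrow> lam \<in> {0<..<1} \<longrightarrow>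
        E L xb (vel_right t0 t1 xb \<theta>) \<theta> \<eta> = 0 \<longrightarrow>
        E L xb (vel_right t0 t1 xb \<theta>) \<theta> ((lam / (lam - 1)) *\<^sub>R \<eta>) = 0 \<longrightarrow>
        (\<exists>D. ((\<lambda>t. Q2 L xb (vel_right t0 t1 xb \<theta>) t lam \<eta>) has_real_derivative D) (at_right \<theta>) \<and>
             lam * M1 L xb (vel_right t0 t1 xb \<theta>) \<theta> lam \<eta> + D \<ge> 0))
   \<and> (\<forall>\<theta> \<alpha> \<eta> lam.
        \<theta> \<in> {t0<..t1} \<longrightarrow> \<alpha> > 0 \<longrightarrow> {\<theta> - \<alpha><..\<theta>} \<subseteq> {t0..t1} \<longrightarrow>
        twice_differentiable_on xb {\<theta> - \<alpha><..\<theta>} \<longrightarrow>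
        \<eta> \<noteq> 0 \<longrightarrow> lam \<in> {0<..<1} \<longrightarrow>
        E L xb (vel_left t0 t1 xb \<theta>) \<theta> \<eta> = 0 \<longrightarrow>
        E L xb (vel_left t0 t1 xb \<theta>) \<theta> ((lam / (lam - 1)) *\<^sub>R \<eta>) = 0 \<longrightarrow>
        (\<exists>D. ((\<lambda>t. Q2 L xb (vel_left t0 t1 xb \<theta>) t lam \<eta>) has_real_derivative D) (at_left \<theta>) \<and>
             lam * M1 L xb (vel_left t0 t1 xb \<theta>) \<theta> lam \<eta> + D \<le> 0))
   \<and> (\<forall>\<theta> \<eta> lam.
        \<theta> \<in> {t0<..<t1} \<longrightarrow> twice_differentiable_at xb \<theta> \<longrightarrow>
        \<eta> \<noteq> 0 \<longrightarrow> lam \<in> {0<..<1} \<longrightarrow>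
        E L xb (vel t0 t1 xb) \<theta> \<eta> = 0 \<longrightarrow>
        E L xb (vel t0 t1 xb) \<theta> ((lam / (lam - 1)) *\<^sub>R \<eta>) = 0 \<longrightarrow>
        lam * (\<Delta>L_x L xb (vel t0 t1 xb) \<theta> \<eta> \<bullet> \<eta>)
          + (1 - lam) * (\<Delta>L_x L xb (vel t0 t1 xb) \<theta> ((lam / (lam - 1)) *\<^sub>R \<eta>) \<bullet> \<eta>) = 0)"
proof -
  let ?\<Omega> = "{a<..<b} \<times> (UNIV :: (real ^ 'n) set) \<times> (UNIV :: (real ^ 'n) set)"
  obtain L' where L': "\<And>p. p \<in> ?\<Omega> \<Longrightarrow> (L has_derivative blinfun_apply (L' p)) (at p)"
    "continuous_on ?\<Omega> L'"
    using assms(3) unfolding C1_on_def by blast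
  have "L_v L differentiable (at p)" if "p \<in> ?\<Omega>" for p
    using assms(4) that unfolding C1_on_def differentiable_def by blast
  then interpret strong_extremal L L' a b t0 t1 x0 x1 xb
    using assms(1,2,5) L' by unfold_locales
  show ?thesis
    using right_condition left_condition two_sided_condition[unfolded M1_def]
    by (intro conjI allI impI) simp_all
qed

end
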